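(* Let $r\ge 3$ and $s\ge 1$ be integers. There exist $\delta>0$ and $N>0$ such that for all integers $n_1\ge n_2\ge\dots\ge n_r$ with $n_r\ge N$ and $n_1\le(1+\delta)n_r$ the following holds. If $r\ne 4$, then $$m_0(s,n_1,\dots,n_r)=s\prod_{\ell=1}^{r-1}n_\ell-\prod_{\ell=1}^{r-1}(n_\ell-1)+n_r-s.$$ If $r=4$, then $$m_0(s,n_1,\dots,n_4)=\max\left\{s\prod_{\ell=1}^{3}n_\ell-\prod_{\ell=1}^{3}(n_\ell-1)+n_4-s,\ \ n_1\bigl(sn_2n_3-(n_2-1)(n_3-1)+n_4-s\bigr)\right\}.$$
   Context: For integers $n_1\ge\dots\ge n_r$, let $X_\ell=[n_\ell]$. An $r$-partite $r$-graph is a family $\mathcal F\subseteq X_1\times\dots\times X_r$; its vertices are the pairs $(\ell,x)$ with $x\in X_\ell$, and an edge $A=(a_1,\dots,a_r)$ contains the vertex $(\ell,x)$ iff $a_\ell=x$. Two edges $A,B$ are disjoint if $A[\ell]\ne B[\ell]$ for all $\ell$. The matching number $\nu(\mathcal F)$ is the maximum number of pairwise disjoint edges of $\mathcal F$. A transversal is a set $T$ of vertices such that every edge of $\mathcal F$ contains a vertex of $T$; $\tau(\mathcal F)$ is the minimum size of a transversal. For integers $r\ge 3$ and $n_1\ge\dots\ge n_r>s\ge 1$, $m_0(s,n_1,\dots,n_r)$ denotes the maximum of $|\mathcal F|$ over all $\mathcal F\subseteq X_1\times\dots\times X_r$ with $\nu(\mathcal F)\le s<\tau(\mathcal F)$.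 *)

theory Defs
  imports Complex_Main "HOL-Library.FuncSet"
begin

text \<open>Parts are indexed by 1..r; part l is X_l = {1..n l}. An edge is an
extensional function A with A l \<in> X_l for l \<in> {1..r}.\<close>

definition edges :: "nat \<Rightarrow> (nat \<Rightarrow> nat) \<Rightarrow> (nat \<Rightarrow> nat) set" where
  "edges r n = PiE {1..r} (\<lambda>l. {1..n l})"

definition disjoint_edges :: "nat \<Rightarrow> (nat \<Rightarrow> nat) \<Rightarrow> (nat \<Rightarrow> nat) \<Rightarrow> bool" where
  "disjoint_edges r A B \<longleftrightarrow> (\<forall>l\<in>{1..r}. A l \<noteq> B l)"

definition is_matching :: "nat \<Rightarrow> (nat \<Rightarrow> nat) set \<Rightarrow> bool" where
  "is_matching r M \<longleftrightarrow> (\<forall>A\<in>M. \<forall>B\<in>M. A \<noteq> B \<longrightarrow> disjoint_edges r A B)"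

definition matching_number :: "nat \<Rightarrow> (nat \<Rightarrow> nat) set \<Rightarrow> nat" where
  "matching_number r F = Max (card ` {M. M \<subseteq> F \<and> is_matching r M})"

definition vertices :: "nat \<Rightarrow> (nat \<Rightarrow> nat) \<Rightarrow> (nat \<times> nat) set" where
  "vertices r n = {(l, x). l \<in> {1..r} \<and> x \<in> {1..n l}}"

definition is_transversal :: "nat \<Rightarrow> (nat \<Rightarrow> nat) \<Rightarrow> (nat \<Rightarrow> nat) set \<Rightarrow> (nat \<times> nat) set \<Rightarrow> bool" where
  "is_transversal r n F T \<longleftrightarrow> T \<subseteq> vertices r n \<and> (\<forall>A\<in>F. \<exists>l\<in>{1..r}. (l, A l) \<in> T)"

definition transversal_number :: "nat \<Rightarrow> (nat \<Rightarrow> nat) \<Rightarrow> (nat \<Rightarrow> nat) set \<Rightarrow> nat" where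
  "transversal_number r n F = Min (card ` {T. is_transversal r n F T})"

definition m0 :: "nat \<Rightarrow> nat \<Rightarrow> (nat \<Rightarrow> nat) \<Rightarrow> nat" where
  "m0 s r n = Max {card F | F. F \<subseteq> edges r n \<and> matching_number r F \<le> s
                               \<and> s < transversal_number r n F}"

end

theory Submission
  imports Defs
begin

text \<open>For the upper bound, call a vertex heavy if its degree has order larger than \<open>n\<^sup>r\<^sup>-\<^sup>2\<close>.
  A matching avoiding heavy vertices extends greedily through them, so there are at most \<open>s - 1\<close>
  heavy vertices, and with fewer than \<open>s - 1\<close> the family is too small. If there are exactly \<open>s - 1\<close>, the
  edges avoiding them form an intersecting family \<open>G\<close> without a one-vertex transversal. Call a pair of
  vertices heavy if its codegree in \<open>G\<close> has order larger than \<open>n\<^sup>r\<^sup>-\<^sup>3\<close>. Every edge of \<open>G\<close> meets every heavy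
  pair, so the heavy pairs pairwise intersect and form a star or a triangle, while only
  \<open>O(n\<^sup>r\<^sup>-\<^sup>3)\<close> edges contain no heavy pair. A star with \<open>r - 1\<close> leaves forces \<open>G\<close> into a Hilton--Milner
  family, a triangle forces every edge to contain two of three fixed vertices, and a smaller star is
  beaten in the leading term. It remains to see that it is best to place all heavy vertices in
  the smallest part, which follows by moving them there one at a time.\<close>

text \<open>The answer is exact, so lower-order losses count, and the edges meeting the
  \<open>s - 1\<close> heavy vertices must be counted together with \<open>G\<close>. If the
  surviving parts have sizes \<open>m l\<close>, the former number exactly the product of the
  \<open>n l\<close> minus the product of the \<open>m l\<close>. Adding \<open>G\<close> cancels
  the product of the \<open>m l\<close>: what remains is the full product minus the number of
  surviving edges missing from \<open>G\<close>. This number, the gap, is to be minimised over all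
  positions of the heavy vertices. Near-equality of \<open>n 1\<close> and \<open>n r\<close> enters
  only where an inferior structure is discarded by its leading term. For r \<ge> 4 a Hilton--Milner
  family has about (r - 1) n^(r-2) edges, a two-of-three family about 3 n^(r-2). Triangles therefore
  lose for r \<ge> 5 and tie to leading order for r = 4, which is the origin of the maximum; for r =
  3 they have exactly the Hilton--Milner size.\<close>

section \<open>Estimates for powers and products\<close>

text \<open>One number \<open>e\<close> serves as the tolerance and as a bound for the reciprocal of
  \<open>d\<close>: the lower-order term costs at most \<open>C * e\<close> in the leading
  coefficient, and \<open>D\<close> exceeds \<open>d - 1\<close> by at most the factor
  \<open>(1 + e) / (1 - e)\<close>. As \<open>e\<close> tends to 0 the resulting coefficient tends
  to \<open>a < b\<close>.\<close>

lemma perturbed_power_less: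
  fixes a b C :: real
  assumes "0 \<le> a" "a < b" "0 \<le> C"
  obtains \<delta> :: real and N :: nat where "0 < \<delta>" "0 < N"
    "\<And>D d :: nat. N \<le> d \<Longrightarrow> d \<le> D \<Longrightarrow> real D \<le> (1 + \<delta>) * real d \<Longrightarrow>
       a * real D ^ Suc p + C * real D ^ p \<le> b * (real d - 1) ^ Suc p"
proof -
  have "((\<lambda>e::real. (a + C * e) * ((1 + e) / (1 - e)) ^ Suc p)
          \<longlongrightarrow> (a + C * 0) * ((1 + 0) / (1 - 0)) ^ Suc p) (at_right 0)"
    by (intro tendsto_intros) auto
  then have "\<forall>\<^sub>F e in at_right (0::real). (a + C * e) * ((1 + e) / (1 - e)) ^ Suc p < b"
    by (rule order_tendstoD) (use assms in simp)
  then obtain e0 where e0: "e0 > 0" "\<And>e. 0 < e \<Longrightarrow> e < e0 \<Longrightarrow>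
      (a + C * e) * ((1 + e) / (1 - e)) ^ Suc p < b"
    unfolding eventually_at_right_field by auto
  \<comment> \<open>Halving puts \<open>e\<close> strictly below \<open>e0\<close>; the cap 1/2
    keeps \<open>1 - e\<close> positive.\<close>
  define e where "e = min (1/2) (e0 / 2)"
  have e: "0 < e" "e < 1" and main: "(a + C * e) * ((1 + e) / (1 - e)) ^ Suc p < b"
    using e0 by (auto simp: e_def min_def)
  define N where "N = Suc (nat \<lceil>1 / e\<rceil>)"
  have N: "real N \<ge> 1 / e"
    unfolding N_def by linarith
  show ?thesis
  proof (rule that[of e N])
    show "0 < e" "0 < N"
      using e by (auto simp: N_def)
    fix D d :: nat
    assume d: "N \<le> d" "d \<le> D" "real D \<le> (1 + e) * real d"
    have d1: "1 / e \<le> real d"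
      using N d by linarith
    then have de: "1 \<le> e * real d"
      using e by (simp add: field_simps)
    have D1: "1 \<le> e * real D"
      using de d(2) e(1) by (smt (verit) mult_left_mono of_nat_mono)
    have dpos: "0 \<le> real d - 1"
      using d(1) by (simp add: N_def)
    have "(1 - e) * real D \<le> (1 - e) * ((1 + e) * real d)"
      using d(3) e by (intro mult_left_mono) auto
    also have "\<dots> = (1 + e) * ((1 - e) * real d)"
      by simp
    also have "\<dots> \<le> (1 + e) * (real d - 1)"
      using de e by (intro mult_left_mono) (auto simp: algebra_simps)
    finally have Dq: "real D \<le> (1 + e) / (1 - e) * (real d - 1)"
      using e by (simp add: field_simps)
    have "C * real D ^ p \<le> C * (e * real D * real D ^ p)"
    proof (rule mult_left_mono[OF _ \<open>0 \<le> C\<close>])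
      show "real D ^ p \<le> e * real D * real D ^ p"
        using mult_right_mono[OF D1, of "real D ^ p"] by simp
    qed
    then have "a * real D ^ Suc p + C * real D ^ p \<le> (a + C * e) * real D ^ Suc p"
      by (simp add: algebra_simps)
    also have "\<dots> \<le> (a + C * e) * ((1 + e) / (1 - e) * (real d - 1)) ^ Suc p"
      using assms e Dq by (intro mult_left_mono power_mono) auto
    also have "\<dots> = ((a + C * e) * ((1 + e) / (1 - e)) ^ Suc p) * (real d - 1) ^ Suc p"
      by (simp only: power_mult_distrib mult.assoc)
    also have "\<dots> \<le> b * (real d - 1) ^ Suc p"
      using main dpos by (intro mult_right_mono) auto
    finally show "a * real D ^ Suc p + C * real D ^ p \<le> b * (real d - 1) ^ Suc p" .
  qed
qed

text \<open>The left side counts tuples that differ from a fixed tuple everywhere; the fixed tuple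
  itself is not among them as soon as there is a coordinate.\<close>

lemma prod_diff_one_le:
  fixes f :: "'a \<Rightarrow> int"
  assumes "finite J" "J \<noteq> {}" "\<And>j. j \<in> J \<Longrightarrow> 1 \<le> f j"
  shows "(\<Prod>j\<in>J. f j - 1) \<le> (\<Prod>j\<in>J. f j) - 1"
  using assms
proof (induction rule: finite_ne_induct)
  case (singleton x)
  then show ?case by simp
next
  case (insert x J)
  have "(\<Prod>j\<in>J. f j - 1) \<le> (\<Prod>j\<in>J. f j) - 1"
    using insert by simp
  moreover have "0 \<le> (\<Prod>j\<in>J. f j - 1)"
    using insert.prems by (intro prod_nonneg) force
  moreover have "1 \<le> f x"
    using insert.prems by simp
  ultimately have "(f x - 1) * (\<Prod>j\<in>J. f j - 1) \<le> (f x - 1) * ((\<Prod>j\<in>J. f j) - 1)"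
    by (intro mult_left_mono) auto
  also have "\<dots> \<le> f x * (\<Prod>j\<in>J. f j) - 1"
    using \<open>1 \<le> f x\<close> \<open>0 \<le> (\<Prod>j\<in>J. f j - 1)\<close> \<open>(\<Prod>j\<in>J. f j - 1) \<le> (\<Prod>j\<in>J. f j) - 1\<close>
    by (simp add: algebra_simps)
  finally show ?case
    using insert by simp
qed

text \<open>The difference counts tuples agreeing with a fixed tuple somewhere; those agreeing in
  exactly one coordinate already suffice. This bounds the leading term of a Hilton--Milner family
  from below.\<close>

lemma prod_minus_prod_diff_one_ge:
  fixes f :: "'a \<Rightarrow> int"
  assumes "finite J" "1 \<le> d" "\<And>j. j \<in> J \<Longrightarrow> d \<le> f j"
  shows "int (card J) * (d - 1) ^ (card J - 1) \<le> (\<Prod>j\<in>J. f j) - (\<Prod>j\<in>J. f j - 1)"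
  using assms(1,3)
proof (induction rule: finite_induct)
  case empty
  then show ?case by simp
next
  case (insert x J)
  let ?P = "\<Prod>j\<in>J. f j" and ?Q = "\<Prod>j\<in>J. f j - 1"
  have IH: "int (card J) * (d - 1) ^ (card J - 1) \<le> ?P - ?Q"
    using insert by simp
  have fx: "d \<le> f x"
    using insert.prems by simp
  have "(\<Prod>j\<in>J. d - 1) \<le> ?Q"
    using insert.prems assms(2) by (intro prod_mono) force
  then have Q: "(d - 1) ^ card J \<le> ?Q"
    by simp
  have "(d - 1) * (int (card J) * (d - 1) ^ (card J - 1)) \<le> f x * (?P - ?Q)"
    using IH fx assms(2) by (intro mult_mono) auto
  moreover have "(d - 1) * (int (card J) * (d - 1) ^ (card J - 1)) = int (card J) * (d - 1) ^ card J"
    by (cases "card J") auto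
  ultimately have "int (card J) * (d - 1) ^ card J + (d - 1) ^ card J \<le> f x * (?P - ?Q) + ?Q"
    using Q by linarith
  then show ?case
    using insert by (simp add: algebra_simps)
qed

text \<open>Units of deficit travel to \<open>q\<close> one at a time, each step keeping
  \<open>m q\<close> minimal. Positivity is demanded only off \<open>q\<close>, so no lower bound on
  \<open>n q - c\<close> has to be carried along; \<open>cong\<close> identifies the final sizes
  with the target, since the two agree only on \<open>I\<close>.\<close>

lemma shift_deficit_to_one_part:
  fixes W :: "(nat \<Rightarrow> int) \<Rightarrow> int" and m n :: "nat \<Rightarrow> int"
  assumes "finite I" "q \<in> I"
    and step: "\<And>m j. \<lbrakk>j \<in> I; j \<noteq> q; \<And>l. l \<in> I - {q} \<Longrightarrow> 1 \<le> m l; \<And>l. l \<in> I \<Longrightarrow> m q \<le> m l\<rbrakk>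
        \<Longrightarrow> W (m(j := m j + 1, q := m q - 1)) \<le> W m"
    and cong: "\<And>m m'. (\<And>l. l \<in> I \<Longrightarrow> m l = m' l) \<Longrightarrow> W m = W m'"
    and "\<And>l. l \<in> I \<Longrightarrow> m l \<le> n l" "\<And>l. l \<in> I - {q} \<Longrightarrow> 1 \<le> m l" "\<And>l. l \<in> I \<Longrightarrow> m q \<le> m l"
    and "(\<Sum>l\<in>I. n l - m l) = c"
  shows "W (n(q := n q - c)) \<le> W m"
  using assms(5-)
proof (induction "nat (\<Sum>l\<in>I - {q}. n l - m l)" arbitrary: m rule: less_induct)
  case less
  have nonneg: "0 \<le> n l - m l" if "l \<in> I" for l
    using less.prems(1)[OF that] by simp
  have sum_q: "(\<Sum>l\<in>I. n l - m l) = (n q - m q) + (\<Sum>l\<in>I - {q}. n l - m l)"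
    using assms(1,2) by (rule sum.remove)
  show ?case
  proof (cases "\<forall>l\<in>I - {q}. n l - m l = 0")
    case True
    then have "(\<Sum>l\<in>I - {q}. n l - m l) = 0"
      by (intro sum.neutral)
    then have "m q = n q - c"
      using sum_q less.prems(4) by simp
    then have "W (n(q := n q - c)) = W m"
      using True by (intro cong) auto
    then show ?thesis by simp
  next
    case False
    then obtain j where j: "j \<in> I" "j \<noteq> q" "m j < n j"
      using nonneg by force
    let ?m = "m(j := m j + 1, q := m q - 1)"
    have rest: "(\<Sum>l\<in>I - {q}. n l - ?m l) = (\<Sum>l\<in>I - {q}. n l - m l) - 1"
      using sum.remove[of "I - {q}" j "\<lambda>l. n l - ?m l"] sum.remove[of "I - {q}" j "\<lambda>l. n l - m l"]
        assms(1) j by simp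
    have pos: "1 \<le> (\<Sum>l\<in>I - {q}. n l - m l)"
    proof -
      have "n j - m j \<le> (\<Sum>l\<in>I - {q}. n l - m l)"
        using assms(1) j nonneg by (intro member_le_sum) auto
      then show ?thesis
        using j by simp
    qed
    have "W (n(q := n q - c)) \<le> W ?m"
    proof (rule less.hyps)
      show "nat (\<Sum>l\<in>I - {q}. n l - ?m l) < nat (\<Sum>l\<in>I - {q}. n l - m l)"
        using rest pos by simp
      have "(\<Sum>l\<in>I. n l - ?m l) = (n q - ?m q) + (\<Sum>l\<in>I - {q}. n l - ?m l)"
        using assms(1,2) by (rule sum.remove)
      then show "(\<Sum>l\<in>I. n l - ?m l) = c"
        using rest sum_q less.prems(4) by simp
      show "?m l \<le> n l" if "l \<in> I" for l
        using less.prems(1)[OF that] j by auto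
      show "1 \<le> ?m l" if "l \<in> I - {q}" for l
        using less.prems(2)[OF that] less.prems(2)[of j] j that by auto
      show "?m q \<le> ?m l" if "l \<in> I" for l
        using less.prems(3)[OF that] j by auto
    qed
    also have "\<dots> \<le> W m"
      using j less.prems by (intro step) auto
    finally show ?thesis .
  qed
qed

section \<open>Optimal position of the heavy vertices\<close>

text \<open>The number of edges in a product with parts of sizes \<open>m\<close> that do not belong to the
  Hilton--Milner family with centre in part \<open>k\<close>: the edges through the centre meeting a fixed edge
  \<open>E\<close> off the centre, together with the edges agreeing with \<open>E\<close> outside part \<open>k\<close>.\<close>

definition hm_gap :: "nat set \<Rightarrow> (nat \<Rightarrow> int) \<Rightarrow> nat \<Rightarrow> int" where
  "hm_gap I m k = (m k - 1) * ((\<Prod>l\<in>I - {k}. m l) - 1) + (\<Prod>l\<in>I - {k}. m l - 1)"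

lemma hm_gap_two_parts:
  assumes "finite I" "j \<in> I" "j \<noteq> k"
  shows "hm_gap I m k = (m k - 1) * (m j * (\<Prod>l\<in>I - {j, k}. m l) - 1)
           + (m j - 1) * (\<Prod>l\<in>I - {j, k}. m l - 1)"
proof -
  have "I - {k} - {j} = I - {j, k}"
    by auto
  then show ?thesis
    using prod.remove[of "I - {k}" j m] prod.remove[of "I - {k}" j "\<lambda>l. m l - 1"] assms
    by (simp add: hm_gap_def)
qed

text \<open>The two gaps differ by \<open>m k - m j\<close> times a factor that is nonnegative
  because a third part exists. So the centre is best placed in a smallest surviving part.\<close>

lemma hm_gap_antimono:
  assumes "finite I" "j \<in> I" "k \<in> I" "I - {j, k} \<noteq> {}"
    and "\<And>l. l \<in> I \<Longrightarrow> 1 \<le> m l" "m j \<le> m k"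
  shows "hm_gap I m j \<le> hm_gap I m k"
proof (cases "j = k")
  case False
  let ?R = "\<Prod>l\<in>I - {j, k}. m l" and ?R' = "\<Prod>l\<in>I - {j, k}. m l - 1"
  have "?R' \<le> ?R - 1"
    using assms by (intro prod_diff_one_le) auto
  then have "0 \<le> (m k - m j) * (?R - ?R' - 1)"
    using assms(6) by simp
  also have "\<dots> = hm_gap I m k - hm_gap I m j"
    using hm_gap_two_parts[of I j k m] hm_gap_two_parts[of I k j m] assms False
    by (simp add: insert_commute algebra_simps)
  finally show ?thesis by simp
qed simp

lemma hm_gap_swap:
  assumes "finite I" "k \<in> I" "q \<in> I"
  shows "hm_gap I (m(k := m q, q := m k)) q = hm_gap I m k"
proof (cases "k = q")
  case False
  let ?m = "m(k := m q, q := m k)"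
  have "(\<Prod>l\<in>I - {k, q}. ?m l) = (\<Prod>l\<in>I - {k, q}. m l)"
    "(\<Prod>l\<in>I - {k, q}. ?m l - 1) = (\<Prod>l\<in>I - {k, q}. m l - 1)"
    by (auto intro!: prod.cong)
  then show ?thesis
    using hm_gap_two_parts[of I k q ?m] hm_gap_two_parts[of I q k m] assms False
    by (simp add: insert_commute)
qed simp

text \<open>With \<open>m j + m q\<close> fixed, moving the two sizes apart lowers their product,
  which carries the factor \<open>?R\<close>; the rest of the change is \<open>1 + ?R' - ?R\<close>,
  nonpositive by the presence of a third part.\<close>

lemma hm_gap_shift:
  assumes "finite I" "j \<in> I" "j \<noteq> q" "I - {j, q} \<noteq> {}"
    and "\<And>l. l \<in> I - {q} \<Longrightarrow> 1 \<le> m l" "m q \<le> m j"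
  shows "hm_gap I (m(j := m j + 1, q := m q - 1)) q \<le> hm_gap I m q"
proof -
  let ?m = "m(j := m j + 1, q := m q - 1)"
  let ?R = "\<Prod>l\<in>I - {j, q}. m l" and ?R' = "\<Prod>l\<in>I - {j, q}. m l - 1"
  have eq: "(\<Prod>l\<in>I - {j, q}. ?m l) = ?R" "(\<Prod>l\<in>I - {j, q}. ?m l - 1) = ?R'"
    by (auto intro!: prod.cong)
  have "?R' \<le> ?R - 1"
    using assms by (intro prod_diff_one_le) auto
  moreover have "0 \<le> ?R"
    using assms(5) by (intro prod_nonneg) force
  then have "?R * (m q - m j - 1) \<le> ?R * (- 1)"
    using assms(6) by (intro mult_left_mono) auto
  moreover have "hm_gap I ?m q - hm_gap I m q = ?R * (m q - m j - 1) + 1 + ?R' - ?R"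
    using assms by (simp add: hm_gap_two_parts[of I j q] eq algebra_simps)
  moreover have "0 \<le> ?R'"
    using assms(5) by (intro prod_nonneg) force
  ultimately show ?thesis by linarith
qed

text \<open>Three moves never increase the gap: recentring at a smallest surviving part
  \<open>k0\<close>, exchanging its size with that of part \<open>q\<close>, and shifting the
  remaining deficit into \<open>q\<close>.\<close>

lemma hm_gap_min:
  assumes "finite I" "3 \<le> card I" "q \<in> I" "k \<in> I"
    and n: "\<And>l. l \<in> I \<Longrightarrow> n q \<le> n l"
    and m: "\<And>l. l \<in> I \<Longrightarrow> m l \<le> n l" "\<And>l. l \<in> I \<Longrightarrow> 1 \<le> m l"
    and c: "(\<Sum>l\<in>I. n l - m l) = c"
  shows "hm_gap I (n(q := n q - c)) q \<le> hm_gap I m k"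
proof -
  have third: "I - {i, j} \<noteq> {}" for i j
  proof
    assume "I - {i, j} = {}"
    then have "card I \<le> card {i, j}"
      by (intro card_mono) auto
    then show False
      using assms(2) by (cases "i = j") auto
  qed
  obtain k0 where k0: "k0 \<in> I" "\<And>l. l \<in> I \<Longrightarrow> m k0 \<le> m l"
    using arg_min_if_finite[of I m] assms(1,3) by (metis empty_iff not_less)
  \<comment> \<open>The exchanged sizes still fit into their parts:
    \<open>m k0 \<le> m q \<le> n q\<close> and \<open>m q \<le> n q \<le> n k0\<close>.\<close>
  let ?m = "m(k0 := m q, q := m k0)"
  have sum_eq: "(\<Sum>l\<in>I. n l - ?m l) = (\<Sum>l\<in>I. n l - m l)"
  proof (cases "k0 = q")
    case False
    have "I = insert k0 (insert q (I - {k0, q}))"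
      using k0 assms(3) by auto
    then have split: "(\<Sum>l\<in>I. f l) = f k0 + f q + (\<Sum>l\<in>I - {k0, q}. f l)" for f :: "nat \<Rightarrow> int"
      using False assms(1) by (metis (no_types, lifting) Diff_iff add.assoc finite_Diff finite_insert
          insert_iff sum.insert)
    have "(\<Sum>l\<in>I - {k0, q}. n l - ?m l) = (\<Sum>l\<in>I - {k0, q}. n l - m l)"
      by (intro sum.cong) auto
    then show ?thesis
      unfolding split[of "\<lambda>l. n l - ?m l"] split[of "\<lambda>l. n l - m l"] using False by simp
  qed simp
  have "hm_gap I (n(q := n q - c)) q \<le> hm_gap I ?m q"
  proof (rule shift_deficit_to_one_part[where W = "\<lambda>m. hm_gap I m q" and I = I])
    show "hm_gap I m q = hm_gap I m' q" if "\<And>l. l \<in> I \<Longrightarrow> m l = m' l" for m m'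
      using that assms(3) by (simp add: hm_gap_def)
    show "?m l \<le> n l" if "l \<in> I" for l
      using m(1)[OF that] m(1)[OF assms(3)] k0(2)[OF assms(3)] n[OF k0(1)] n[OF that] by auto
    show "1 \<le> ?m l" if "l \<in> I - {q}" for l
      using m(2) that assms(3) by auto
    show "?m q \<le> ?m l" if "l \<in> I" for l
      using k0 that assms(3) by auto
    show "(\<Sum>l\<in>I. n l - ?m l) = c"
      using sum_eq c by simp
    show "hm_gap I (m(j := m j + 1, q := m q - 1)) q \<le> hm_gap I m q"
      if "j \<in> I" "j \<noteq> q" "\<And>l. l \<in> I - {q} \<Longrightarrow> 1 \<le> m l" "\<And>l. l \<in> I \<Longrightarrow> m q \<le> m l" for m j
      using that assms(1) third by (intro hm_gap_shift) auto
  qed (use assms in auto)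
  also have "\<dots> = hm_gap I m k0"
    using assms k0 by (intro hm_gap_swap) auto
  also have "\<dots> \<le> hm_gap I m k"
    using assms k0 third by (intro hm_gap_antimono) auto
  finally show ?thesis .
qed

section \<open>Optimal position for the two-of-three families\<close>

text \<open>The same count for the edges containing at least two of three fixed vertices, taken from the parts
  of sizes \<open>b\<close>, \<open>c\<close> and \<open>d\<close>.\<close>

definition two_of_three_gap :: "int \<Rightarrow> int \<Rightarrow> int \<Rightarrow> int \<Rightarrow> int" where
  "two_of_three_gap a b c d = a * (b * c * d - b - c - d + 2)"

lemma two_of_three_gap_perm:
  "two_of_three_gap a c b d = two_of_three_gap a b c d"
  "two_of_three_gap a d c b = two_of_three_gap a b c d"
  "two_of_three_gap a b d c = two_of_three_gap a b c d"
  by (simp_all add: two_of_three_gap_def algebra_simps)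

text \<open>The first argument is the part without a fixed vertex. Exchanging it with a larger part
  does not raise the gap, so the largest part should be left free.\<close>

lemma two_of_three_gap_antimono:
  assumes "a \<le> b" "1 \<le> c" "1 \<le> d"
  shows "two_of_three_gap b a c d \<le> two_of_three_gap a b c d"
proof -
  have "0 \<le> (b - a) * (c + d - 2)"
    using assms by simp
  also have "\<dots> = two_of_three_gap a b c d - two_of_three_gap b a c d"
    by (simp add: two_of_three_gap_def algebra_simps)
  finally show ?thesis by simp
qed

text \<open>Here the restored vertex lies in the free part, so beside the product term there remains
  \<open>- b - c + 2\<close>, which is nonpositive.\<close>

lemma two_of_three_gap_shift_first:
  assumes "1 \<le> b" "1 \<le> c" "d \<le> a"
  shows "two_of_three_gap (a + 1) b c (d - 1) \<le> two_of_three_gap a b c d"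
proof -
  have "1 \<le> b * c"
    using assms mult_mono[of 1 b 1 c] by simp
  then have "(b * c - 1) * (d - 1 - a) \<le> 0"
    using assms by (intro mult_nonneg_nonpos) auto
  moreover have "two_of_three_gap (a + 1) b c (d - 1) - two_of_three_gap a b c d
      = (b * c - 1) * (d - 1 - a) - b - c + 2"
    by (simp add: two_of_three_gap_def algebra_simps)
  ultimately show ?thesis
    using assms by linarith
qed

lemma two_of_three_gap_shift:
  assumes "1 \<le> a" "1 \<le> c" "d \<le> b"
  shows "two_of_three_gap a (b + 1) c (d - 1) \<le> two_of_three_gap a b c d"
proof -
  have "two_of_three_gap a (b + 1) c (d - 1) - two_of_three_gap a b c d = (a * c) * (d - 1 - b)"
    by (simp add: two_of_three_gap_def algebra_simps)
  also have "\<dots> \<le> 0"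
    using assms by (intro mult_nonneg_nonpos) auto
  finally show ?thesis by simp
qed

lemma two_of_three_gap_min_aux:
  assumes m: "m1 \<le> n1" "m2 \<le> n2" "m3 \<le> n3" "m4 \<le> n4"
    and pos: "1 \<le> m1" "1 \<le> m2" "1 \<le> m3" and min: "m4 \<le> m1" "m4 \<le> m2" "m4 \<le> m3"
    and c: "(n1 - m1) + (n2 - m2) + (n3 - m3) + (n4 - m4) = c"
  shows "two_of_three_gap n1 n2 n3 (n4 - c) \<le> two_of_three_gap m1 m2 m3 m4"
proof -
  let ?W = "\<lambda>m::nat \<Rightarrow> int. two_of_three_gap (m 1) (m 2) (m 3) (m 4)"
  let ?f = "\<lambda>a b c d (l::nat). if l = 1 then a else if l = 2 then b else if l = 3 then c else d :: int"
  have "?W ((?f n1 n2 n3 n4)(4 := ?f n1 n2 n3 n4 4 - c)) \<le> ?W (?f m1 m2 m3 m4)"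
  proof (rule shift_deficit_to_one_part[where W = ?W and I = "{1, 2, 3, 4}"])
    fix m :: "nat \<Rightarrow> int" and j :: nat
    assume j: "j \<in> {1, 2, 3, 4}" "j \<noteq> 4"
      and pos: "\<And>l. l \<in> {1, 2, 3, 4} - {4} \<Longrightarrow> 1 \<le> m l"
      and min: "\<And>l. l \<in> {1, 2, 3, 4} \<Longrightarrow> m 4 \<le> m l"
    have p: "1 \<le> m 1" "1 \<le> m 2" "1 \<le> m 3" "m 4 \<le> m 1" "m 4 \<le> m 2" "m 4 \<le> m 3"
      using pos min by auto
    from j consider "j = 1" | "j = 2" | "j = 3"
      by auto
    then show "?W (m(j := m j + 1, 4 := m 4 - 1)) \<le> ?W m"
    proof cases
      case 1
      then show ?thesis
        using two_of_three_gap_shift_first[of "m 2" "m 3" "m 4" "m 1"] p by simp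
    next
      case 2
      then show ?thesis
        using two_of_three_gap_shift[of "m 1" "m 3" "m 4" "m 2"] p by simp
    next
      case 3
      then show ?thesis
        using two_of_three_gap_shift[of "m 1" "m 2" "m 4" "m 3"] p
        by (simp add: two_of_three_gap_perm(1)[of _ "m 2"])
    qed
  qed (use assms in auto)
  then show ?thesis by simp
qed

text \<open>The three fixed parts enter symmetrically, so they may be permuted until a smallest one
  stands last. The permuted sizes still fit: in the second case, \<open>m4 \<le> n4 \<le> n3\<close>
  and \<open>m3 \<le> m4 \<le> n4\<close>.\<close>

lemma two_of_three_gap_min_max_first:
  assumes n: "n2 \<le> n1" "n3 \<le> n2" "n4 \<le> n3"
    and m: "m1 \<le> n1" "m2 \<le> n2" "m3 \<le> n3" "m4 \<le> n4"
    and pos: "1 \<le> m1" "1 \<le> m2" "1 \<le> m3" "1 \<le> m4" and max: "m2 \<le> m1" "m3 \<le> m1" "m4 \<le> m1"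
    and c: "(n1 - m1) + (n2 - m2) + (n3 - m3) + (n4 - m4) = c"
  shows "two_of_three_gap n1 n2 n3 (n4 - c) \<le> two_of_three_gap m1 m2 m3 m4"
proof -
  consider "m4 \<le> m2" "m4 \<le> m3" | "m3 \<le> m2" "m3 \<le> m4" | "m2 \<le> m3" "m2 \<le> m4"
    by linarith
  then show ?thesis
  proof cases
    case 1
    then show ?thesis
      using assms by (intro two_of_three_gap_min_aux) auto
  next
    case 2
    then have "two_of_three_gap n1 n2 n3 (n4 - c) \<le> two_of_three_gap m1 m2 m4 m3"
      using assms by (intro two_of_three_gap_min_aux) auto
    then show ?thesis
      by (simp add: two_of_three_gap_perm(3)[of m1 m2 m3])
  next
    case 3
    then have "two_of_three_gap n1 n2 n3 (n4 - c) \<le> two_of_three_gap m1 m4 m3 m2"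
      using assms by (intro two_of_three_gap_min_aux) auto
    then show ?thesis
      by (simp add: two_of_three_gap_perm(2)[of m1 m2 m3])
  qed
qed

text \<open>Nothing says which part a triangle leaves free, so all four choices are bounded at once:
  freeing a largest surviving part gives the smallest of the four gaps, and that one is bounded
  after reordering.\<close>

lemma two_of_three_gap_min:
  fixes m1 m2 m3 m4 n1 n2 n3 n4 c :: int
  assumes n: "n2 \<le> n1" "n3 \<le> n2" "n4 \<le> n3"
    and m: "m1 \<le> n1" "m2 \<le> n2" "m3 \<le> n3" "m4 \<le> n4"
    and pos: "1 \<le> m1" "1 \<le> m2" "1 \<le> m3" "1 \<le> m4"
    and c: "(n1 - m1) + (n2 - m2) + (n3 - m3) + (n4 - m4) = c"
  shows "two_of_three_gap n1 n2 n3 (n4 - c) \<le> Min {two_of_three_gap m1 m2 m3 m4,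
    two_of_three_gap m2 m1 m3 m4, two_of_three_gap m3 m1 m2 m4, two_of_three_gap m4 m1 m2 m3}"
proof -
  let ?g = "two_of_three_gap n1 n2 n3 (n4 - c)"
  let ?t1 = "two_of_three_gap m1 m2 m3 m4" and ?t2 = "two_of_three_gap m2 m1 m3 m4"
    and ?t3 = "two_of_three_gap m3 m1 m2 m4" and ?t4 = "two_of_three_gap m4 m1 m2 m3"
  have perms: "two_of_three_gap m1 m3 m2 m4 = ?t1" "two_of_three_gap m1 m4 m2 m3 = ?t1"
    "two_of_three_gap m2 m3 m1 m4 = ?t2" "two_of_three_gap m2 m4 m1 m3 = ?t2"
    "two_of_three_gap m3 m2 m1 m4 = ?t3" "two_of_three_gap m3 m4 m1 m2 = ?t3"
    "two_of_three_gap m4 m2 m1 m3 = ?t4" "two_of_three_gap m4 m3 m1 m2 = ?t4"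
    "two_of_three_gap m4 m2 m3 m1 = ?t4"
    by (simp_all add: two_of_three_gap_def algebra_simps)
  have comp: "m1 \<le> m2 \<Longrightarrow> ?t2 \<le> ?t1" "m2 \<le> m1 \<Longrightarrow> ?t1 \<le> ?t2"
    "m1 \<le> m3 \<Longrightarrow> ?t3 \<le> ?t1" "m3 \<le> m1 \<Longrightarrow> ?t1 \<le> ?t3"
    "m1 \<le> m4 \<Longrightarrow> ?t4 \<le> ?t1" "m4 \<le> m1 \<Longrightarrow> ?t1 \<le> ?t4"
    "m2 \<le> m3 \<Longrightarrow> ?t3 \<le> ?t2" "m3 \<le> m2 \<Longrightarrow> ?t2 \<le> ?t3"
    "m2 \<le> m4 \<Longrightarrow> ?t4 \<le> ?t2" "m4 \<le> m2 \<Longrightarrow> ?t2 \<le> ?t4"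
    "m3 \<le> m4 \<Longrightarrow> ?t4 \<le> ?t3" "m4 \<le> m3 \<Longrightarrow> ?t3 \<le> ?t4"
    using two_of_three_gap_antimono[of m1 m2 m3 m4] two_of_three_gap_antimono[of m2 m1 m3 m4]
      two_of_three_gap_antimono[of m1 m3 m2 m4] two_of_three_gap_antimono[of m3 m1 m2 m4]
      two_of_three_gap_antimono[of m1 m4 m2 m3] two_of_three_gap_antimono[of m4 m1 m2 m3]
      two_of_three_gap_antimono[of m2 m3 m1 m4] two_of_three_gap_antimono[of m3 m2 m1 m4]
      two_of_three_gap_antimono[of m2 m4 m1 m3] two_of_three_gap_antimono[of m4 m2 m1 m3]
      two_of_three_gap_antimono[of m3 m4 m1 m2] two_of_three_gap_antimono[of m4 m3 m1 m2] pos
    by (simp_all add: perms)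
  consider "m2 \<le> m1" "m3 \<le> m1" "m4 \<le> m1" | "m1 \<le> m2" "m3 \<le> m2" "m4 \<le> m2"
    | "m1 \<le> m3" "m2 \<le> m3" "m4 \<le> m3" | "m1 \<le> m4" "m2 \<le> m4" "m3 \<le> m4"
    by linarith
  then have "?g \<le> ?t1 \<and> ?g \<le> ?t2 \<and> ?g \<le> ?t3 \<and> ?g \<le> ?t4"
  proof cases
    case 1
    then have "?g \<le> ?t1"
      using assms by (intro two_of_three_gap_min_max_first) auto
    then show ?thesis
      using comp 1 by force
  next
    case 2
    then have "?g \<le> ?t2"
      using assms by (intro two_of_three_gap_min_max_first) auto
    then show ?thesis
      using comp 2 by force
  next
    case 3
    then have "?g \<le> two_of_three_gap m3 m2 m1 m4"
      using assms by (intro two_of_three_gap_min_max_first) auto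
    then show ?thesis
      using comp 3 perms by force
  next
    case 4
    then have "?g \<le> two_of_three_gap m4 m2 m3 m1"
      using assms by (intro two_of_three_gap_min_max_first) auto
    then show ?thesis
      using comp 4 perms by force
  qed
  then show ?thesis by simp
qed

section \<open>Nontrivial intersecting families\<close>

lemma card_PiE_through_le:
  assumes "finite I" "J \<subseteq> I" "\<And>l. l \<in> I \<Longrightarrow> finite (Y l)" "\<And>l. l \<in> I \<Longrightarrow> card (Y l) \<le> D"
  shows "card {A \<in> PiE I Y. \<forall>l\<in>J. A l = f l} \<le> D ^ (card I - card J)"
proof -
  have "{A \<in> PiE I Y. \<forall>l\<in>J. A l = f l} \<subseteq> PiE I (\<lambda>l. if l \<in> J then {f l} else Y l)"
    by (auto simp: PiE_iff extensional_def)
  then have "card {A \<in> PiE I Y. \<forall>l\<in>J. A l = f l} \<le> card (PiE I (\<lambda>l. if l \<in> J then {f l} else Y l))"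
    using assms by (intro card_mono finite_PiE) auto
  also have "\<dots> = (\<Prod>l\<in>I. if l \<in> J then 1 else card (Y l))"
    using assms(1) by (subst card_PiE) (auto intro!: prod.cong)
  also have "\<dots> = (\<Prod>l\<in>I - J. card (Y l))"
    using assms(1) by (intro prod.mono_neutral_cong_right) auto
  also have "\<dots> \<le> (\<Prod>l\<in>I - J. D)"
    using assms by (intro prod_mono) auto
  also have "\<dots> = D ^ (card I - card J)"
    using assms(1,2) by (simp add: card_Diff_subset finite_subset)
  finally show ?thesis .
qed

lemma card_through_pair_le:
  assumes "finite I" "\<And>l. l \<in> I \<Longrightarrow> finite (Y l)" "\<And>l. l \<in> I \<Longrightarrow> card (Y l) \<le> D"
    and "i \<in> I" "j \<in> I" "i \<noteq> j"
  shows "card {A \<in> PiE I Y. A i = x \<and> A j = y} \<le> D ^ (card I - 2)"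
  using card_PiE_through_le[of I "{i, j}" Y D "(\<lambda>_. x)(j := y)"] assms
  by (simp add: numeral_2_eq_2)

lemma card_through_triple_le:
  assumes "finite I" "\<And>l. l \<in> I \<Longrightarrow> finite (Y l)" "\<And>l. l \<in> I \<Longrightarrow> card (Y l) \<le> D"
    and "i \<in> I" "j \<in> I" "k \<in> I" "i \<noteq> j" "i \<noteq> k" "j \<noteq> k"
  shows "card {A \<in> PiE I Y. A i = x \<and> A j = y \<and> A k = z} \<le> D ^ (card I - 3)"
  using card_PiE_through_le[of I "{i, j, k}" Y D "(\<lambda>_. x)(j := y, k := z)"] assms
  by (simp add: numeral_3_eq_3)

lemma card_PiE_fun_upd:
  assumes "finite I" "k \<in> I"
  shows "card (PiE I (Y(k := S))) = card S * (\<Prod>l\<in>I - {k}. card (Y l))"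
proof -
  have "card (PiE I (Y(k := S))) = card S * (\<Prod>l\<in>I - {k}. card ((Y(k := S)) l))"
    using assms by (simp add: card_PiE prod.remove)
  also have "(\<Prod>l\<in>I - {k}. card ((Y(k := S)) l)) = (\<Prod>l\<in>I - {k}. card (Y l))"
    by (intro prod.cong) auto
  finally show ?thesis .
qed

lemma card_PiE_fun_upd3:
  assumes "finite I" "a \<in> I" "b \<in> I" "c \<in> I" "a \<noteq> b" "a \<noteq> c" "b \<noteq> c"
  shows "card (PiE I (Y(a := S, b := T, c := U)))
    = card S * card T * card U * (\<Prod>l\<in>I - {a, b, c}. card (Y l))"
proof -
  let ?Z = "Y(a := S, b := T, c := U)"
  have I: "I = insert a (insert b (insert c (I - {a, b, c})))"
    using assms by auto
  have "card (PiE I ?Z) = (\<Prod>l\<in>I. card (?Z l))"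
    using assms by (simp add: card_PiE)
  also have "\<dots> = (\<Prod>l\<in>insert a (insert b (insert c (I - {a, b, c}))). card (?Z l))"
    using I by simp
  also have "\<dots> = card S * card T * card U * (\<Prod>l\<in>I - {a, b, c}. card (?Z l))"
    using assms by simp
  also have "(\<Prod>l\<in>I - {a, b, c}. card (?Z l)) = (\<Prod>l\<in>I - {a, b, c}. card (Y l))"
    by (intro prod.cong) auto
  finally show ?thesis .
qed

section \<open>Heavy pairs, stars and triangles\<close>

abbreviation through :: "nat \<times> nat \<Rightarrow> (nat \<Rightarrow> nat) \<Rightarrow> bool" where
  "through v A \<equiv> A (fst v) = snd v"

text \<open>The sets \<open>Y l\<close> stand for parts from which heavy vertices have been deleted;
  they may have uneven sizes and share only the bound \<open>D\<close>. Since \<open>x\<close> in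
  \<open>nontrivial\<close> is arbitrary, the condition also makes \<open>G\<close>
  nonempty.\<close>

locale nontrivial_intersecting =
  fixes r D :: nat and Y :: "nat \<Rightarrow> nat set" and G :: "(nat \<Rightarrow> nat) set"
  assumes r_ge: "3 \<le> r"
    and finite_Y: "\<And>l. l \<in> {1..r} \<Longrightarrow> finite (Y l)"
    and card_Y: "\<And>l. l \<in> {1..r} \<Longrightarrow> card (Y l) \<le> D"
    and G_subset: "G \<subseteq> PiE {1..r} Y"
    and intersecting: "\<And>A B. A \<in> G \<Longrightarrow> B \<in> G \<Longrightarrow> \<exists>l\<in>{1..r}. A l = B l"
    and nontrivial: "\<And>l x. l \<in> {1..r} \<Longrightarrow> \<exists>A\<in>G. A l \<noteq> x"
begin

text \<open>The threshold is what a single edge missing both vertices can meet: at most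
  \<open>D ^ (r - 3)\<close> edges through the pair at each of its \<open>r\<close>
  vertices.\<close>

definition heavy :: "nat \<times> nat \<Rightarrow> nat \<times> nat \<Rightarrow> bool" where
  "heavy u v \<longleftrightarrow> fst u \<in> {1..r} \<and> fst v \<in> {1..r} \<and> fst u \<noteq> fst v
     \<and> r * D ^ (r - 3) < card {A \<in> G. through u A \<and> through v A}"

lemma finite_G: "finite G"
  by (rule finite_subset[OF G_subset finite_PiE]) (simp_all add: finite_Y)

lemma heavy_sym: "heavy u v \<longleftrightarrow> heavy v u"
  by (auto simp: heavy_def conj_commute)

lemma heavy_imp_edge:
  assumes "heavy u v"
  obtains A where "A \<in> G" "through u A" "through v A"
proof -
  have "{A \<in> G. through u A \<and> through v A} \<noteq> {}"
    using assms unfolding heavy_def by (metis card.empty not_less_zero)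
  then show ?thesis
    using that by auto
qed

lemma card_through_triple_G_le:
  assumes "fst u \<in> {1..r}" "fst v \<in> {1..r}" "fst w \<in> {1..r}" "fst u \<noteq> fst v" "w \<noteq> u" "w \<noteq> v"
  shows "card {A \<in> G. through u A \<and> through v A \<and> through w A} \<le> D ^ (r - 3)"
proof (cases "fst w = fst u \<or> fst w = fst v")
  case True
  then have "{A \<in> G. through u A \<and> through v A \<and> through w A} = {}"
    using assms(5,6) by (auto simp: prod_eq_iff)
  then show ?thesis
    by (metis card.empty le0)
next
  case False
  have "card {A \<in> G. through u A \<and> through v A \<and> through w A}
      \<le> card {A \<in> PiE {1..r} Y. through u A \<and> through v A \<and> through w A}"
    using G_subset finite_Y by (intro card_mono finite_Collect_conjI disjI1) (auto intro: finite_PiE)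
  also have "\<dots> \<le> D ^ (card {1..r} - 3)"
    using False assms finite_Y card_Y by (intro card_through_triple_le) auto
  finally show ?thesis by simp
qed

lemma edge_meets_heavy:
  assumes "heavy u v" "E \<in> G"
  shows "through u E \<or> through v E"
proof (rule ccontr)
  assume no: "\<not> ?thesis"
  have uv: "fst u \<in> {1..r}" "fst v \<in> {1..r}" "fst u \<noteq> fst v"
    using assms(1) by (auto simp: heavy_def)
  let ?S = "\<lambda>l. {A \<in> G. through u A \<and> through v A \<and> through (l, E l) A}"
  have "{A \<in> G. through u A \<and> through v A} \<subseteq> (\<Union>l\<in>{1..r}. ?S l)"
    using intersecting[OF _ assms(2)] by auto
  then have "card {A \<in> G. through u A \<and> through v A} \<le> card (\<Union>l\<in>{1..r}. ?S l)"
    using finite_G by (intro card_mono) auto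
  also have "\<dots> \<le> (\<Sum>l\<in>{1..r}. card (?S l))"
    by (rule card_UN_le) simp
  also have "\<dots> \<le> (\<Sum>l\<in>{1..r}. D ^ (r - 3))"
    using uv no by (intro sum_mono card_through_triple_G_le) auto
  finally show False
    using assms(1) by (simp add: heavy_def)
qed

text \<open>All edges through the first pair pass through \<open>u'\<close> or \<open>v'\<close>. If
  the pairs were disjoint, this would leave at most \<open>2 * D ^ (r - 3)\<close> of them, below
  the threshold.\<close>

lemma heavy_pairs_meet:
  assumes "heavy u v" "heavy u' v'"
  shows "{u, v} \<inter> {u', v'} \<noteq> {}"
proof
  assume disj: "{u, v} \<inter> {u', v'} = {}"
  have uv: "fst u \<in> {1..r}" "fst v \<in> {1..r}" "fst u \<noteq> fst v" "fst u' \<in> {1..r}" "fst v' \<in> {1..r}"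
    using assms by (auto simp: heavy_def)
  let ?S = "\<lambda>w. {A \<in> G. through u A \<and> through v A \<and> through w A}"
  have "{A \<in> G. through u A \<and> through v A} \<subseteq> ?S u' \<union> ?S v'"
    using edge_meets_heavy[OF assms(2)] by auto
  then have "card {A \<in> G. through u A \<and> through v A} \<le> card (?S u' \<union> ?S v')"
    using finite_G by (intro card_mono) auto
  also have "\<dots> \<le> card (?S u') + card (?S v')"
    by (rule card_Un_le)
  also have "\<dots> \<le> D ^ (r - 3) + D ^ (r - 3)"
    using uv disj by (intro add_mono card_through_triple_G_le) auto
  also have "\<dots> = 2 * D ^ (r - 3)"
    by simp
  also have "\<dots> \<le> r * D ^ (r - 3)"
    using r_ge by (intro mult_right_mono) auto
  finally show False
    using assms(1) by (simp add: heavy_def)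
qed

text \<open>A heavy pair avoiding \<open>u\<close> must contain \<open>v\<close>, and one avoiding
  \<open>v\<close> must contain \<open>u\<close>; as these two meet, they share a third vertex and
  close a triangle.\<close>

lemma heavy_star_or_triangle:
  assumes "heavy u v"
  obtains (star) c where "fst c \<in> {1..r}" "\<And>x y. heavy x y \<Longrightarrow> x = c \<or> y = c"
  | (triangle) w where "heavy u w" "heavy v w"
proof -
  have uv: "fst u \<in> {1..r}" "fst v \<in> {1..r}" "u \<noteq> v"
    using assms by (auto simp: heavy_def)
  show thesis
  proof (cases "(\<forall>x y. heavy x y \<longrightarrow> x = u \<or> y = u) \<or> (\<forall>x y. heavy x y \<longrightarrow> x = v \<or> y = v)")
    case True
    then show thesis
      using star[of u] star[of v] uv by blast
  next
    case False
    then obtain x y x' y' where *: "heavy x y" "x \<noteq> u" "y \<noteq> u" "heavy x' y'" "x' \<noteq> v" "y' \<noteq> v"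
      by blast
    then obtain w where w: "heavy v w" "w \<noteq> u"
      using heavy_pairs_meet[OF assms *(1)] heavy_sym by blast
    obtain w' where w': "heavy u w'" "w' \<noteq> v"
      using heavy_pairs_meet[OF assms *(4)] heavy_sym * by blast
    have "w = w'"
      using heavy_pairs_meet[OF w(1) w'(1)] w w' uv by auto
    then show thesis
      using triangle w w' by blast
  qed
qed

text \<open>Two factors \<open>r\<close> come from locating an edge: it meets a fixed
  \<open>E\<close> at some \<open>l\<close>, and it meets an edge \<open>B l\<close>, chosen to
  avoid the vertex \<open>(l, E l)\<close>, at some other \<open>k\<close>. The third is the
  codegree bound for a pair that is not heavy.\<close>

lemma card_light_le:
  "card {A \<in> G. \<not> (\<exists>u v. heavy u v \<and> through u A \<and> through v A)} \<le> r ^ 3 * D ^ (r - 3)"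
proof -
  let ?L = "{A \<in> G. \<not> (\<exists>u v. heavy u v \<and> through u A \<and> through v A)}"
  obtain E where E: "E \<in> G"
    using nontrivial[of 1 0] r_ge by auto
  have "\<forall>l\<in>{1..r}. \<exists>B\<in>G. B l \<noteq> E l"
    using nontrivial by blast
  then obtain B where B: "\<And>l. l \<in> {1..r} \<Longrightarrow> B l \<in> G" "\<And>l. l \<in> {1..r} \<Longrightarrow> B l l \<noteq> E l"
    by metis
  let ?S = "\<lambda>(l, k). {A \<in> ?L. l \<noteq> k \<and> A l = E l \<and> A k = B l k}"
  have "?L \<subseteq> (\<Union>p\<in>{1..r} \<times> {1..r}. ?S p)"
  proof
    fix A assume A: "A \<in> ?L"
    then obtain l where l: "l \<in> {1..r}" "A l = E l"
      using intersecting[OF _ E] by blast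
    then obtain k where k: "k \<in> {1..r}" "A k = B l k"
      using intersecting[OF _ B(1)] A by blast
    have "l \<noteq> k"
      using l k B(2) by metis
    then show "A \<in> (\<Union>p\<in>{1..r} \<times> {1..r}. ?S p)"
      using A l k by blast
  qed
  then have "card ?L \<le> card (\<Union>p\<in>{1..r} \<times> {1..r}. ?S p)"
    using finite_G by (intro card_mono) auto
  also have "\<dots> \<le> (\<Sum>p\<in>{1..r} \<times> {1..r}. card (?S p))"
    by (rule card_UN_le) simp
  also have "\<dots> \<le> (\<Sum>p\<in>{1..r} \<times> {1..r}. r * D ^ (r - 3))"
  proof (rule sum_mono)
    fix p assume p: "p \<in> {1..r} \<times> {1..r}"
    obtain l k where [simp]: "p = (l, k)"
      by (cases p)
    show "card (?S p) \<le> r * D ^ (r - 3)"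
    proof (cases "l = k \<or> heavy (l, E l) (k, B l k)")
      case True
      then have empty: "?S p = {}"
        by fastforce
      show ?thesis
        unfolding empty by simp
    next
      case False
      then have "card {A \<in> G. A l = E l \<and> A k = B l k} \<le> r * D ^ (r - 3)"
        using p by (auto simp: heavy_def)
      moreover have "card (?S p) \<le> card {A \<in> G. A l = E l \<and> A k = B l k}"
        using finite_G by (intro card_mono) auto
      ultimately show ?thesis by linarith
    qed
  qed
  also have "\<dots> = r ^ 3 * D ^ (r - 3)"
    by (simp add: card_cartesian_product power3_eq_cube)
  finally show ?thesis .
qed

lemma card_triangle_le:
  assumes "heavy u v" "heavy u w" "heavy v w"
  shows "int (card G) \<le> (\<Prod>l\<in>{1..r} - {fst u, fst v, fst w}. int (card (Y l)))
    * (int (card (Y (fst u))) + int (card (Y (fst v))) + int (card (Y (fst w))) - 2)"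
proof -
  obtain a x b y c z where [simp]: "u = (a, x)" "v = (b, y)" "w = (c, z)"
    by (cases u, cases v, cases w)
  have abc: "a \<in> {1..r}" "b \<in> {1..r}" "c \<in> {1..r}" "a \<noteq> b" "a \<noteq> c" "b \<noteq> c"
    using assms by (auto simp: heavy_def)
  have xyz: "x \<in> Y a" "y \<in> Y b" "z \<in> Y c"
  proof -
    obtain A where "A \<in> G" "A a = x" "A b = y"
      using heavy_imp_edge[OF assms(1)] by auto
    moreover obtain B where "B \<in> G" "B c = z"
      using heavy_imp_edge[OF assms(3)] by auto
    ultimately show "x \<in> Y a" "y \<in> Y b" "z \<in> Y c"
      using G_subset abc by (auto simp: PiE_iff)
  qed
  let ?R = "\<Prod>l\<in>{1..r} - {a, b, c}. card (Y l)"
  let ?P = "\<lambda>S T U. PiE {1..r} (Y(a := S, b := T, c := U))"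
  have P: "card (?P S T U) = card S * card T * card U * ?R" for S T U
    using abc by (intro card_PiE_fun_upd3) auto
  have fin: "finite (?P S T U)" if "finite S" "finite T" "finite U" for S T U
    using that finite_Y by (intro finite_PiE) auto
  have finY: "finite (Y a)" "finite (Y b)" "finite (Y c)"
    using finite_Y abc by auto
  \<comment> \<open>Edges through all three vertices are counted in the first box only; removing
    \<open>y\<close> and \<open>x\<close> in the other two produces the \<open>- 2\<close>.\<close>
  have "G \<subseteq> ?P {x} {y} (Y c) \<union> ?P {x} (Y b - {y}) {z} \<union> ?P (Y a - {x}) {y} {z}"
  proof
    fix A assume A: "A \<in> G"
    have "A a = x \<or> A b = y" "A a = x \<or> A c = z" "A b = y \<or> A c = z"
      using edge_meets_heavy[OF assms(1) A] edge_meets_heavy[OF assms(2) A]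
        edge_meets_heavy[OF assms(3) A] by auto
    moreover have "A \<in> PiE {1..r} Y"
      using A G_subset by auto
    ultimately show "A \<in> ?P {x} {y} (Y c) \<union> ?P {x} (Y b - {y}) {z} \<union> ?P (Y a - {x}) {y} {z}"
      using abc by (auto simp: PiE_iff)
  qed
  then have "card G \<le> card (?P {x} {y} (Y c) \<union> ?P {x} (Y b - {y}) {z} \<union> ?P (Y a - {x}) {y} {z})"
    using finY by (intro card_mono finite_UnI fin) auto
  also have "\<dots> \<le> card (?P {x} {y} (Y c)) + card (?P {x} (Y b - {y}) {z}) + card (?P (Y a - {x}) {y} {z})"
    by (intro order.trans[OF card_Un_le] add_mono card_Un_le order.refl)
  also have "\<dots> = card (Y c) * ?R + (card (Y b) - 1) * ?R + (card (Y a) - 1) * ?R"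
    unfolding P using xyz by simp
  finally have "int (card G) \<le> int (card (Y c) * ?R + (card (Y b) - 1) * ?R + (card (Y a) - 1) * ?R)"
    by (simp only: of_nat_le_iff)
  also have "\<dots> = int ?R * (int (card (Y a)) + int (card (Y b)) + int (card (Y c)) - 2)"
  proof -
    have "card (Y a) \<noteq> 0" "card (Y b) \<noteq> 0"
      using xyz finY by auto
    then obtain p q where "card (Y a) = Suc p" "card (Y b) = Suc q"
      by (meson not0_implies_Suc)
    then show ?thesis
      by (simp add: algebra_simps)
  qed
  finally show ?thesis by simp
qed

text \<open>An edge \<open>E\<close> avoiding the centre meets every heavy pair, so all leaves lie
  on \<open>E\<close>, at most one in each part other than \<open>k\<close>. With a leaf missing,
  the leading coefficient is at most \<open>r - 2\<close>; with all \<open>r - 1\<close> present,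
  every edge avoiding the centre contains them all and agrees with \<open>E\<close> off
  \<open>k\<close>.\<close>

lemma card_star_le:
  assumes c: "fst c \<in> {1..r}" "\<And>x y. heavy x y \<Longrightarrow> x = c \<or> y = c"
  shows "card G \<le> (r - 2) * D ^ (r - 2) + r ^ 3 * D ^ (r - 3)
    \<or> (\<exists>k\<in>{1..r}. int (card G) \<le> (\<Prod>l\<in>{1..r}. int (card (Y l)))
         - hm_gap {1..r} (\<lambda>l. int (card (Y l))) k)"
proof -
  obtain k x where [simp]: "c = (k, x)"
    by (cases c)
  have k: "k \<in> {1..r}"
    using c by simp
  obtain E where E: "E \<in> G" "E k \<noteq> x"
    using nontrivial[OF k] by auto
  define L where "L = {w. heavy c w}"
  have L_E: "snd w = E (fst w)" if "w \<in> L" for w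
    using edge_meets_heavy[of c w E] that E by (auto simp: L_def)
  have L_sub: "fst ` L \<subseteq> {1..r} - {k}"
    by (auto simp: L_def heavy_def)
  have inj: "inj_on fst L"
    using L_E by (auto simp: inj_on_def prod_eq_iff)
  have finL: "finite L"
    using L_sub inj finite_imageD finite_subset by blast
  have "card L = card (fst ` L)"
    using inj by (simp add: card_image)
  then have cardL: "card L \<le> r - 1"
    using card_mono[OF _ L_sub] k by simp
  have EY: "E l \<in> Y l" if "l \<in> {1..r}" for l
    using E G_subset that by (auto simp: PiE_iff)
  show ?thesis
  proof (cases "card L \<le> r - 2")
    case True
    let ?S = "\<lambda>w. {A \<in> G. through c A \<and> through w A}"
    let ?light = "{A \<in> G. \<not> (\<exists>u v. heavy u v \<and> through u A \<and> through v A)}"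
    have "G \<subseteq> (\<Union>w\<in>L. ?S w) \<union> ?light"
    proof
      fix A assume A: "A \<in> G"
      show "A \<in> (\<Union>w\<in>L. ?S w) \<union> ?light"
      proof (cases "A \<in> ?light")
        case False
        then obtain u v where "heavy u v" "through u A" "through v A"
          using A by blast
        then obtain w where "heavy c w" "through c A" "through w A"
          using c(2)[of u v] heavy_sym by blast
        then have "A \<in> ?S w" "w \<in> L"
          using A by (auto simp: L_def)
        then show ?thesis by blast
      qed simp
    qed
    then have "card G \<le> card ((\<Union>w\<in>L. ?S w) \<union> ?light)"
      using finite_G finL by (intro card_mono) auto
    also have "\<dots> \<le> card (\<Union>w\<in>L. ?S w) + card ?light"
      by (rule card_Un_le)
    also have "\<dots> \<le> card L * D ^ (r - 2) + r ^ 3 * D ^ (r - 3)"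
    proof (rule add_mono[OF _ card_light_le])
      have "card (\<Union>w\<in>L. ?S w) \<le> (\<Sum>w\<in>L. card (?S w))"
        using finL by (rule card_UN_le)
      also have "\<dots> \<le> (\<Sum>w\<in>L. D ^ (r - 2))"
      proof (rule sum_mono)
        fix w assume "w \<in> L"
        then have w: "fst w \<in> {1..r}" "fst c \<noteq> fst w"
          by (auto simp: L_def heavy_def)
        have "card (?S w) \<le> card {A \<in> PiE {1..r} Y. through c A \<and> through w A}"
          using G_subset finite_Y
          by (intro card_mono finite_Collect_conjI disjI1) (auto intro: finite_PiE)
        also have "\<dots> \<le> D ^ (card {1..r} - 2)"
          using w c finite_Y card_Y by (intro card_through_pair_le) auto
        finally show "card (?S w) \<le> D ^ (r - 2)"
          by simp
      qed
      finally show "card (\<Union>w\<in>L. ?S w) \<le> card L * D ^ (r - 2)"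
        by simp
    qed
    also have "\<dots> \<le> (r - 2) * D ^ (r - 2) + r ^ 3 * D ^ (r - 3)"
      using True by (intro add_right_mono mult_right_mono) auto
    finally show ?thesis ..
  next
    case False
    then have "card (fst ` L) = r - 1"
      using cardL inj by (simp add: card_image)
    then have fstL: "fst ` L = {1..r} - {k}"
      using L_sub k by (intro card_subset_eq) auto
    have heavy_l: "heavy c (l, E l)" if "l \<in> {1..r}" "l \<noteq> k" for l
    proof -
      have "l \<in> fst ` L"
        unfolding fstL using that by simp
      then obtain w where "w \<in> L" "fst w = l"
        by auto
      then show ?thesis
        using L_E[of w] by (cases w) (auto simp: L_def)
    qed
    \<comment> \<open>\<open>?P\<close> is the full star of the centre, \<open>?Q\<close> its edges
      missing \<open>E\<close>, and \<open>?T\<close> consists of the edges avoiding the centre that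
      agree with \<open>E\<close> elsewhere.\<close>
    let ?P = "PiE {1..r} (Y(k := {x}))"
    let ?Q = "PiE {1..r} ((\<lambda>l. Y l - {E l})(k := {x}))"
    let ?T = "PiE {1..r} ((\<lambda>l. {E l})(k := Y k - {x}))"
    have G_cover: "G \<subseteq> (?P - ?Q) \<union> ?T"
    proof
      fix A assume A: "A \<in> G"
      then have AY: "A \<in> PiE {1..r} Y"
        using G_subset by auto
      show "A \<in> (?P - ?Q) \<union> ?T"
      proof (cases "A k = x")
        case True
        obtain l where l: "l \<in> {1..r}" "A l = E l"
          using intersecting[OF A E(1)] by auto
        then have "l \<noteq> k"
          using True E by auto
        then have "A \<notin> ?Q"
          using l by (force simp: PiE_iff)
        moreover have "A \<in> ?P"
          using AY True by (auto simp: PiE_iff)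
        ultimately show ?thesis by simp
      next
        case False
        then have "A l = E l" if "l \<in> {1..r}" "l \<noteq> k" for l
          using edge_meets_heavy[OF heavy_l[OF that] A] by simp
        then have "A \<in> ?T"
          using AY False k by (auto simp: PiE_iff)
        then show ?thesis by simp
      qed
    qed
    \<comment> \<open>A heavy pair through the centre provides an edge there, so \<open>x\<close> is
      in \<open>Y k\<close>; the size \<open>card (Y k) - 1\<close> of \<open>?T\<close> relies on
      it.\<close>
    obtain l where "l \<in> {1..r}" "l \<noteq> k"
      using r_ge by (intro that[of "if k = 1 then 2 else 1"]) auto
    then obtain A where "A \<in> G" "A k = x"
      using heavy_imp_edge[OF heavy_l] by auto
    then have x: "x \<in> Y k"
      using G_subset k by (auto simp: PiE_iff)
    have finP: "finite ?P" "finite ?Q" "finite ?T"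
      using finite_Y k by (auto intro!: finite_PiE)
    have "?Q \<subseteq> ?P"
      by (intro PiE_mono) auto
    have "card G \<le> card ((?P - ?Q) \<union> ?T)"
      using G_cover finP by (intro card_mono) auto
    also have "\<dots> \<le> card (?P - ?Q) + card ?T"
      by (rule card_Un_le)
    finally have "int (card G) \<le> int (card ?P) - int (card ?Q) + int (card ?T)"
      using \<open>?Q \<subseteq> ?P\<close> finP card_Diff_subset[of ?Q ?P] card_mono[of ?P ?Q] by simp
    moreover have "int (card ?P) = (\<Prod>l\<in>{1..r} - {k}. int (card (Y l)))"
      using k by (simp add: card_PiE_fun_upd)
    moreover have "int (card ?Q) = (\<Prod>l\<in>{1..r} - {k}. int (card (Y l)) - 1)"
    proof -
      have card1: "int (card (Y l - {E l})) = int (card (Y l)) - 1" if "l \<in> {1..r}" for l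
        using EY[OF that] finite_Y[OF that] card_gt_0_iff[of "Y l"] by (auto simp: of_nat_diff)
      show ?thesis
        using k card1 by (simp add: card_PiE_fun_upd)
    qed
    moreover have "int (card ?T) = int (card (Y k)) - 1"
      using x finite_Y[OF k] card_gt_0_iff[of "Y k"] k
      by (auto simp: card_PiE_fun_upd of_nat_diff)
    moreover have "(\<Prod>l\<in>{1..r}. int (card (Y l)))
        = int (card (Y k)) * (\<Prod>l\<in>{1..r} - {k}. int (card (Y l)))"
      using k by (intro prod.remove) auto
    ultimately have "int (card G) \<le> (\<Prod>l\<in>{1..r}. int (card (Y l)))
         - hm_gap {1..r} (\<lambda>l. int (card (Y l))) k"
      by (simp add: hm_gap_def algebra_simps)
    then show ?thesis
      using k by blast
  qed
qed

text \<open>For \<open>r \<ge> 5\<close> a triangle yields at most \<open>3 * D ^ (r - 2)\<close>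
  edges, absorbed by the small case because \<open>3 \<le> r - 2\<close>; the exact count is kept
  only for \<open>r = 3\<close> and \<open>r = 4\<close>.\<close>

lemma card_cases:
  obtains (small) "card G \<le> (r - 2) * D ^ (r - 2) + r ^ 3 * D ^ (r - 3)"
  | (hm) k where "k \<in> {1..r}"
      "int (card G) \<le> (\<Prod>l\<in>{1..r}. int (card (Y l))) - hm_gap {1..r} (\<lambda>l. int (card (Y l))) k"
  | (two_of_three) a b c where "r = 3 \<or> r = 4" "a \<in> {1..r}" "b \<in> {1..r}" "c \<in> {1..r}"
      "a \<noteq> b" "a \<noteq> c" "b \<noteq> c"
      "int (card G) \<le> (\<Prod>l\<in>{1..r} - {a, b, c}. int (card (Y l)))
         * (int (card (Y a)) + int (card (Y b)) + int (card (Y c)) - 2)"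
proof (cases "\<exists>u v. heavy u v")
  case False
  then have "card G \<le> r ^ 3 * D ^ (r - 3)"
    using card_light_le by simp
  then show thesis
    by (intro small) simp
next
  case True
  then obtain u v where uv: "heavy u v"
    by blast
  then show thesis
  proof (cases rule: heavy_star_or_triangle)
    case (star c)
    then show thesis
      using card_star_le[of c] small hm by blast
  next
    case (triangle w)
    have parts: "fst u \<in> {1..r}" "fst v \<in> {1..r}" "fst w \<in> {1..r}"
      "fst u \<noteq> fst v" "fst u \<noteq> fst w" "fst v \<noteq> fst w"
      using uv triangle by (auto simp: heavy_def)
    note le = card_triangle_le[OF uv triangle]
    show thesis
    proof (cases "r \<le> 4")
      case True
      then show thesis
        using two_of_three[OF _ parts le] r_ge by linarith
    next
      case False
      let ?J = "{1..r} - {fst u, fst v, fst w}"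
      have "(\<Prod>l\<in>?J. int (card (Y l))) \<le> (\<Prod>l\<in>?J. int D)"
        using card_Y by (intro prod_mono) auto
      also have "\<dots> = int D ^ (r - 3)"
        using parts by (simp add: card_Diff_subset numeral_3_eq_3)
      finally have R: "(\<Prod>l\<in>?J. int (card (Y l))) \<le> int D ^ (r - 3)" .
      have "(\<Prod>l\<in>?J. int (card (Y l)))
          * (int (card (Y (fst u))) + int (card (Y (fst v))) + int (card (Y (fst w))) - 2)
          \<le> (\<Prod>l\<in>?J. int (card (Y l))) * (3 * int D)"
        using card_Y[OF parts(1)] card_Y[OF parts(2)] card_Y[OF parts(3)]
        by (intro mult_left_mono prod_nonneg) auto
      also have "\<dots> \<le> int D ^ (r - 3) * (3 * int D)"
        using R by (intro mult_right_mono) auto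
      finally have "int (card G) \<le> int D ^ (r - 3) * (3 * int D)"
        using le by linarith
      then have "int (card G) \<le> 3 * (int D ^ (r - 3) * int D)"
        by (simp add: algebra_simps)
      also have "int D ^ (r - 3) * int D = int D ^ (r - 2)"
        using r_ge by (metis Suc_diff_le Suc_eq_plus1 diff_Suc_Suc mult.commute numeral_2_eq_2 numeral_3_eq_3 power_Suc)
      finally have "card G \<le> 3 * D ^ (r - 2)"
        by (metis of_nat_le_iff of_nat_mult of_nat_numeral of_nat_power)
      also have "\<dots> \<le> (r - 2) * D ^ (r - 2)"
        using False by (intro mult_right_mono) auto
      finally show thesis
        by (intro small) simp
    qed
  qed
qed

end

section \<open>Heavy vertices\<close>

lemma finite_edges: "finite (edges r n)"
  unfolding edges_def by (intro finite_PiE) auto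

lemma finite_vertices: "finite (vertices r n)"
proof -
  have "vertices r n = (SIGMA l:{1..r}. {1..n l})"
    by (auto simp: vertices_def)
  then show ?thesis by simp
qed

lemma matching_number_le_iff:
  assumes "F \<subseteq> edges r n"
  shows "matching_number r F \<le> s \<longleftrightarrow> (\<forall>M. M \<subseteq> F \<longrightarrow> is_matching r M \<longrightarrow> card M \<le> s)"
proof -
  have "finite F"
    using assms finite_edges finite_subset by blast
  then have "finite (card ` {M. M \<subseteq> F \<and> is_matching r M})"
    by (intro finite_imageI) auto
  moreover have "card ` {M. M \<subseteq> F \<and> is_matching r M} \<noteq> {}"
    by (auto simp: is_matching_def)
  ultimately show ?thesis
    unfolding matching_number_def by (subst Max_le_iff) auto
qed

lemma less_transversal_number_iff:
  assumes "F \<subseteq> edges r n" "1 \<le> r"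
  shows "s < transversal_number r n F \<longleftrightarrow> (\<forall>T. is_transversal r n F T \<longrightarrow> s < card T)"
proof -
  have "finite {T. is_transversal r n F T}"
    by (rule finite_subset[of _ "Pow (vertices r n)"]) (auto simp: is_transversal_def finite_vertices)
  then have "finite (card ` {T. is_transversal r n F T})"
    by simp
  moreover have "is_transversal r n F (vertices r n)"
    using assms by (fastforce simp: is_transversal_def vertices_def edges_def PiE_iff)
  then have "card ` {T. is_transversal r n F T} \<noteq> {}"
    by auto
  ultimately show ?thesis
    unfolding transversal_number_def by (subst Min_gr_iff) auto
qed

text \<open>The edge chosen at \<open>v\<close> must avoid the vertices of \<open>M\<close>, at most
  \<open>r * (s + 1)\<close>, and the other vertices of \<open>H\<close>, at most
  \<open>s + 1\<close>, so that these stay available. Each forbidden vertex spoils at most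
  \<open>D ^ (r - 2)\<close> edges through \<open>v\<close>; this is the origin of the degree
  threshold.\<close>

lemma extend_matching:
  assumes F: "F \<subseteq> edges r n" and r: "2 \<le> r" and D: "\<And>l. l \<in> {1..r} \<Longrightarrow> n l \<le> D"
    and "finite H" "\<And>v. v \<in> H \<Longrightarrow> fst v \<in> {1..r}"
    and "\<And>v. v \<in> H \<Longrightarrow> (r + 1) * (s + 1) * D ^ (r - 2) < card {A \<in> F. through v A}"
    and "M \<subseteq> F" "is_matching r M" "\<And>A v. A \<in> M \<Longrightarrow> v \<in> H \<Longrightarrow> \<not> through v A"
    and "card M + card H \<le> s + 1"
  shows "\<exists>M'\<subseteq>F. is_matching r M' \<and> card M' = card M + card H"
  using assms(4-)
proof (induction H arbitrary: M rule: finite_induct)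
  case empty
  then show ?case by auto
next
  case (insert v H)
  have finF: "finite F"
    using F finite_edges finite_subset by blast
  then have finM: "finite M"
    using insert.prems(3) finite_subset by blast
  have v: "fst v \<in> {1..r}"
    using insert.prems(1) by simp
  define W where "W = H \<union> (\<Union>A\<in>M. (\<lambda>l. (l, A l)) ` {1..r})"
  have finW: "finite W"
    using insert.hyps finM by (auto simp: W_def)
  have W_part: "fst w \<in> {1..r}" if "w \<in> W" for w
    using that insert.prems(1)[of w] by (auto simp: W_def)
  have v_W: "v \<notin> W"
    using insert.hyps insert.prems(5)[of _ v] by (fastforce simp: W_def)
  have "card (\<Union>A\<in>M. (\<lambda>l. (l, A l)) ` {1..r}) \<le> (\<Sum>A\<in>M. card ((\<lambda>l. (l, A l)) ` {1..r}))"
    using finM by (rule card_UN_le)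
  also have "\<dots> \<le> (\<Sum>A\<in>M. r)"
    by (intro sum_mono order.trans[OF card_image_le]) auto
  finally have "card W \<le> card H + card M * r"
    unfolding W_def by (intro order.trans[OF card_Un_le]) simp
  also have "\<dots> \<le> (s + 1) + (s + 1) * r"
    using insert.prems(6) insert.hyps by (intro add_mono mult_right_mono) auto
  finally have cardW: "card W \<le> (r + 1) * (s + 1)"
    by (simp add: algebra_simps)
  have pair: "card {A \<in> F. through v A \<and> through w A} \<le> D ^ (r - 2)" if "w \<in> W" for w
  proof (cases "fst w = fst v")
    case True
    then have empty: "{A \<in> F. through v A \<and> through w A} = {}"
      using that v_W by (metis (mono_tags, lifting) empty_Collect_eq prod_eqI)
    show ?thesis
      unfolding empty by simp
  next
    case False
    have "card {A \<in> F. through v A \<and> through w A} \<le> card {A \<in> PiE {1..r} (\<lambda>l. {1..n l}). through v A \<and> through w A}"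
      using F finite_edges[of r n] unfolding edges_def by (intro card_mono) auto
    also have "\<dots> \<le> D ^ (card {1..r} - 2)"
      using D v W_part[OF that] False by (intro card_through_pair_le) auto
    finally show ?thesis by simp
  qed
  have "card (\<Union>w\<in>W. {A \<in> F. through v A \<and> through w A}) \<le> (\<Sum>w\<in>W. card {A \<in> F. through v A \<and> through w A})"
    using finW by (rule card_UN_le)
  also have "\<dots> \<le> (\<Sum>w\<in>W. D ^ (r - 2))"
    using pair by (rule sum_mono)
  also have "\<dots> \<le> (r + 1) * (s + 1) * D ^ (r - 2)"
    using mult_right_mono[OF cardW, of "D ^ (r - 2)"] by simp
  also have "\<dots> < card {A \<in> F. through v A}"
    using insert.prems(2) by simp
  finally have "\<not> {A \<in> F. through v A} \<subseteq> (\<Union>w\<in>W. {A \<in> F. through v A \<and> through w A})"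
    using finF finW by (metis (no_types, lifting) card_mono finite_Collect_conjI finite_UN not_less
        finite_subset mem_Collect_eq subsetI)
  then obtain A where A: "A \<in> F" "through v A" "\<And>w. w \<in> W \<Longrightarrow> \<not> through w A"
    by blast
  have "A \<notin> M"
    using insert.prems(5) A(2) by blast
  have A_disj: "A l \<noteq> B l" if "B \<in> M" "l \<in> {1..r}" for B l
  proof -
    have "(l, B l) \<in> W"
      unfolding W_def using that by blast
    then show ?thesis
      using A(3) by fastforce
  qed
  have "\<exists>M'\<subseteq>F. is_matching r M' \<and> card M' = card (insert A M) + card H"
  proof (rule insert.IH)
    show "is_matching r (insert A M)"
      using insert.prems(4) A_disj by (fastforce simp: is_matching_def disjoint_edges_def)
    show "\<not> through w B" if "B \<in> insert A M" "w \<in> H" for B w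
      using that A(3)[of w] insert.prems(5)[of B w] by (auto simp: W_def)
    show "card (insert A M) + card H \<le> s + 1"
      using insert.prems(6) insert.hyps \<open>A \<notin> M\<close> finM by simp
  qed (use insert.prems A in auto)
  then show ?case
    using insert.hyps \<open>A \<notin> M\<close> finM by simp
qed

text \<open>A matching of size \<open>s + 1\<close> would arise from the empty matching if
  \<open>card H > s\<close>, from one edge avoiding \<open>H\<close> if \<open>card H = s\<close>,
  and from two disjoint ones if \<open>card H = s - 1\<close>. In the last case nontriviality holds
  because \<open>H\<close> with one further vertex is too small to be a transversal.\<close>

lemma heavy_vertices:
  assumes F: "F \<subseteq> edges r n" and r: "3 \<le> r" and s: "1 \<le> s" and D: "\<And>l. l \<in> {1..r} \<Longrightarrow> n l \<le> D"
    and nu: "matching_number r F \<le> s" and tau: "s < transversal_number r n F"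
  obtains H where "H \<subseteq> vertices r n" "card H < s"
    "card {A \<in> F. \<forall>v\<in>H. \<not> through v A} \<le> s * r * ((r + 1) * (s + 1) * D ^ (r - 2))"
    "card H = s - 1 \<longrightarrow> (\<forall>A\<in>{A \<in> F. \<forall>v\<in>H. \<not> through v A}.
       \<forall>B\<in>{A \<in> F. \<forall>v\<in>H. \<not> through v A}. \<exists>l\<in>{1..r}. A l = B l)"
    "card H = s - 1 \<longrightarrow> (\<forall>l\<in>{1..r}. \<forall>x. \<exists>A\<in>{A \<in> F. \<forall>v\<in>H. \<not> through v A}. A l \<noteq> x)"
proof -
  let ?K = "(r + 1) * (s + 1) * D ^ (r - 2)"
  define H where "H = {v \<in> vertices r n. ?K < card {A \<in> F. through v A}}"
  have finF: "finite F"
    using F finite_edges finite_subset by blast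
  have H_sub: "H \<subseteq> vertices r n"
    by (auto simp: H_def)
  then have finH: "finite H"
    using finite_vertices finite_subset by blast
  have nu': "card M \<le> s" if "M \<subseteq> F" "is_matching r M" for M
    using nu that by (simp add: matching_number_le_iff[OF F])
  have tau': "s < card T" if "is_transversal r n F T" for T
    using tau that r by (simp add: less_transversal_number_iff[OF F])
  have ext: "card M + card H' \<le> s"
    if "H' \<subseteq> H" "M \<subseteq> F" "is_matching r M" "\<And>A v. A \<in> M \<Longrightarrow> v \<in> H' \<Longrightarrow> \<not> through v A"
      "card M + card H' \<le> s + 1" for H' M
  proof -
    have "\<exists>M'\<subseteq>F. is_matching r M' \<and> card M' = card M + card H'"
    proof (rule extend_matching[OF F])
      show "finite H'"
        using that(1) finH finite_subset by blast
      show "?K < card {A \<in> F. through v A}" "fst v \<in> {1..r}" if "v \<in> H'" for v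
        using that \<open>H' \<subseteq> H\<close> by (auto simp: H_def vertices_def)
    qed (use r D that in auto)
    then show ?thesis
      using nu' by metis
  qed
  have "card H \<le> s"
  proof (rule ccontr)
    assume "\<not> card H \<le> s"
    then obtain H' where "H' \<subseteq> H" "card H' = s + 1"
      using obtain_subset_with_card_n[of "s + 1" H] by auto
    then show False
      using ext[of H' "{}"] by (simp add: is_matching_def)
  qed
  have not_transversal: "\<exists>A\<in>F. \<forall>v\<in>T. \<not> through v A" if "T \<subseteq> vertices r n" "card T \<le> s" for T
  proof (rule ccontr)
    assume "\<not> ?thesis"
    then have "\<forall>A\<in>F. \<exists>v\<in>T. through v A"
      by blast
    then have "is_transversal r n F T"
      using that(1) by (fastforce simp: is_transversal_def vertices_def)
    then show False
      using tau' that(2) by fastforce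
  qed
  have "card H \<noteq> s"
  proof
    assume eq: "card H = s"
    then obtain A where A: "A \<in> F" "\<forall>v\<in>H. \<not> through v A"
      using not_transversal H_sub by blast
    then have "card {A} + card H \<le> s"
      using eq by (intro ext) (auto simp: is_matching_def)
    then show False
      using eq by simp
  qed
  then have "card H < s"
    using \<open>card H \<le> s\<close> by simp
  let ?G = "{A \<in> F. \<forall>v\<in>H. \<not> through v A}"
  have card_G: "card ?G \<le> s * r * ?K"
  proof -
    \<comment> \<open>A maximal matching of \<open>?G\<close> meets every edge of \<open>?G\<close>;
      it covers at most \<open>s * r\<close> vertices, none of them heavy.\<close>
    let ?C = "{M. M \<subseteq> ?G \<and> is_matching r M}"
    have "finite ?C"
      using finF by simp
    moreover have "{} \<in> ?C"
      by (simp add: is_matching_def)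
    ultimately obtain M where M: "M \<in> ?C" "\<And>M'. M' \<in> ?C \<Longrightarrow> M \<subseteq> M' \<Longrightarrow> M' = M"
      using finite_has_maximal2[of ?C "{}"] by (metis (no_types, lifting))
    have cardM: "card M \<le> s"
      using M nu'[of M] by auto
    have finM: "finite M"
      using M(1) finF finite_subset[of M F] by auto
    have cover: "?G \<subseteq> (\<Union>A\<in>M. \<Union>l\<in>{1..r}. {B \<in> F. B l = A l})"
    proof
      fix B assume B: "B \<in> ?G"
      show "B \<in> (\<Union>A\<in>M. \<Union>l\<in>{1..r}. {B \<in> F. B l = A l})"
      proof (rule ccontr)
        assume no: "\<not> ?thesis"
        then have neq: "B l \<noteq> A l" if "A \<in> M" "l \<in> {1..r}" for A l
          using B that by blast
        then have disj: "disjoint_edges r A B" "disjoint_edges r B A" if "A \<in> M" for A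
          using that unfolding disjoint_edges_def by metis+
        then have "insert B M \<in> ?C"
          using M(1) B by (auto simp: is_matching_def)
        then have "B \<in> M"
          using M(2) by blast
        then show False
          using no B r by fastforce
      qed
    qed
    have light: "card {B \<in> F. B l = A l} \<le> ?K" if "A \<in> M" "l \<in> {1..r}" for A l
    proof -
      have "A \<in> edges r n" and avoid: "\<forall>v\<in>H. \<not> through v A"
        using M(1) F that by auto
      then have "(l, A l) \<in> vertices r n"
        using that by (auto simp: vertices_def edges_def PiE_iff)
      moreover have "(l, A l) \<notin> H"
        using avoid by fastforce
      ultimately show ?thesis
        by (simp add: H_def)
    qed
    have "card ?G \<le> card (\<Union>A\<in>M. \<Union>l\<in>{1..r}. {B \<in> F. B l = A l})"
      using finF finM cover by (intro card_mono) auto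
    also have "\<dots> \<le> (\<Sum>A\<in>M. \<Sum>l\<in>{1..r}. card {B \<in> F. B l = A l})"
      using finM by (intro order.trans[OF card_UN_le] sum_mono card_UN_le) auto
    also have "\<dots> \<le> (\<Sum>A\<in>M. \<Sum>l\<in>{1..r}. ?K)"
      using light by (intro sum_mono)
    also have "\<dots> = card M * (r * ?K)"
      by simp
    also have "\<dots> \<le> s * (r * ?K)"
      using cardM by (rule mult_right_mono) simp
    finally show ?thesis
      by (simp only: mult.assoc)
  qed
  have G_intersecting: "\<exists>l\<in>{1..r}. A l = B l" if "card H = s - 1" "A \<in> ?G" "B \<in> ?G" for A B
  proof (rule ccontr)
    assume no: "\<not> ?thesis"
    then have "A \<noteq> B"
      using r by auto
    then have "card {A, B} + card H \<le> s"
      using no that s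
      by (intro ext) (auto simp: is_matching_def disjoint_edges_def)
    then show False
      using \<open>A \<noteq> B\<close> that(1) s by simp
  qed
  have G_nontrivial: "\<exists>A\<in>?G. A l \<noteq> x" if "card H = s - 1" "l \<in> {1..r}" for l x
  proof -
    \<comment> \<open>\<open>x\<close> is arbitrary, whereas a transversal must lie in
      \<open>vertices r n\<close>; hence the intersection.\<close>
    let ?T = "insert (l, x) H \<inter> vertices r n"
    have "card ?T \<le> card (insert (l, x) H)"
      using finH by (intro card_mono) auto
    also have "\<dots> \<le> s"
      using that(1) s finH by (simp add: card_insert_if)
    finally obtain A where A: "A \<in> F" "\<forall>v\<in>?T. \<not> through v A"
      using not_transversal[of ?T] by auto
    have "A \<in> edges r n"
      using A F by auto
    then have "(l, A l) \<in> vertices r n"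
      using that(2) by (auto simp: vertices_def edges_def PiE_iff)
    then show ?thesis
      using A H_sub by (intro bexI[of _ A]) auto
  qed
  show thesis
    using that[OF H_sub \<open>card H < s\<close> card_G] G_intersecting G_nontrivial by blast
qed

section \<open>Extremal constructions\<close>

lemma card_le_m0:
  assumes "F \<subseteq> edges r n" "matching_number r F \<le> s" "s < transversal_number r n F"
  shows "card F \<le> m0 s r n"
  unfolding m0_def
proof (rule Max_ge)
  have "{card F | F. F \<subseteq> edges r n \<and> matching_number r F \<le> s \<and> s < transversal_number r n F}
      \<subseteq> card ` Pow (edges r n)"
    by auto
  then show "finite {card F | F. F \<subseteq> edges r n \<and> matching_number r F \<le> s \<and> s < transversal_number r n F}"
    by (rule finite_subset) (simp add: finite_edges)
qed (use assms in blast)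

lemma m0_attained:
  assumes "F \<subseteq> edges r n" "matching_number r F \<le> s" "s < transversal_number r n F"
  obtains F' where "F' \<subseteq> edges r n" "matching_number r F' \<le> s" "s < transversal_number r n F'"
    "card F' = m0 s r n"
proof -
  let ?S = "{card F | F. F \<subseteq> edges r n \<and> matching_number r F \<le> s \<and> s < transversal_number r n F}"
  have "?S \<subseteq> card ` Pow (edges r n)"
    by auto
  then have "finite ?S"
    by (rule finite_subset) (simp add: finite_edges)
  moreover have "?S \<noteq> {}"
    using assms by blast
  ultimately have "Max ?S \<in> ?S"
    by (rule Max_in)
  then show thesis
    unfolding m0_def[symmetric] using that by auto
qed

text \<open>The vertices 1, ..., s - 1 of the last part carry full stars, each used at most once in
  a matching. The edge \<open>B\<close> and its shifts certify that no vertex meets all of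
  \<open>G\<close>: a vertex meeting \<open>B\<close> in part \<open>l\<close> misses
  \<open>B(l := B l + 1)\<close>.\<close>

lemma stars_plus_intersecting:
  assumes r: "1 \<le> r" and s: "1 \<le> s" and n: "\<And>l. l \<in> {1..r} \<Longrightarrow> s < n l"
    and G: "G \<subseteq> edges r n" "\<And>A. A \<in> G \<Longrightarrow> s \<le> A r"
    and int: "\<And>A B. A \<in> G \<Longrightarrow> B \<in> G \<Longrightarrow> \<exists>l\<in>{1..r}. A l = B l"
    and B: "B \<in> G" "\<And>l. l \<in> {1..r} \<Longrightarrow> B(l := B l + 1) \<in> G"
  shows "\<exists>F\<subseteq>edges r n. matching_number r F \<le> s \<and> s < transversal_number r n F
    \<and> card F = (s - 1) * (\<Prod>l=1..r-1. n l) + card G"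
proof -
  let ?P = "PiE {1..r} ((\<lambda>l. {1..n l})(r := {1..<s}))"
  let ?F = "?P \<union> G"
  have P_edges: "?P \<subseteq> edges r n"
    unfolding edges_def using n[of r] r by (intro PiE_mono) auto
  then have F: "?F \<subseteq> edges r n"
    using G by auto
  have P_r: "1 \<le> A r \<and> A r < s" if "A \<in> ?P" for A
    using PiE_mem[OF that, of r] r by simp
  have "finite ?P" "finite G"
    using P_edges G(1) finite_edges finite_subset by blast+
  moreover have "?P \<inter> G = {}"
    using P_r G(2) by fastforce
  moreover have "{1..r} - {r} = {1..r-1}"
    by auto
  ultimately have card_F: "card ?F = (s - 1) * (\<Prod>l=1..r-1. n l) + card G"
    using r by (simp add: card_Un_disjoint card_PiE_fun_upd)
  have "card M \<le> s" if M: "M \<subseteq> ?F" "is_matching r M" for M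
  proof -
    have finM: "finite M"
      using M(1) F finite_edges finite_subset by metis
    have eq: "A = B" if "A \<in> M" "B \<in> M" "l \<in> {1..r}" "A l = B l" for A B l
      using M(2) that unfolding is_matching_def disjoint_edges_def by blast
    have "inj_on (\<lambda>A. A r) (M \<inter> ?P)"
      using eq r by (auto simp: inj_on_def)
    then have "card (M \<inter> ?P) = card ((\<lambda>A. A r) ` (M \<inter> ?P))"
      by (simp add: card_image)
    also have "\<dots> \<le> card {1..<s}"
      using P_r by (intro card_mono) auto
    finally have "card (M \<inter> ?P) \<le> s - 1"
      by simp
    moreover have "card (M - ?P) \<le> 1"
    proof -
      have "A = B" if "A \<in> M - ?P" "B \<in> M - ?P" for A B
      proof -
        have "A \<in> G" "B \<in> G"
          using that M(1) by auto
        then show ?thesis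
          using int[of A B] eq that by blast
      qed
      then show ?thesis
        using finM by (simp add: card_le_Suc0_iff_eq)
    qed
    moreover have "card M = card (M \<inter> ?P) + card (M - ?P)"
      using finM by (metis card_Int_Diff)
    ultimately show ?thesis
      using s by simp
  qed
  then have nu: "matching_number r ?F \<le> s"
    unfolding matching_number_le_iff[OF F] by blast
  have "s < card T" if T: "is_transversal r n ?F T" for T
  proof (rule ccontr)
    assume "\<not> s < card T"
    then have cardT: "card T \<le> s"
      by simp
    have finT: "finite T"
      using T finite_vertices finite_subset by (auto simp: is_transversal_def)
    have hit: "\<exists>l\<in>{1..r}. (l, A l) \<in> T" if "A \<in> ?F" for A
      using T that by (auto simp: is_transversal_def)
    show False
    \<comment> \<open>If \<open>T\<close> misses a star vertex, an edge of that star escapes, since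
      every part has more than \<open>s\<close> vertices and hence one outside \<open>T\<close>.
      Otherwise at most one vertex of \<open>T\<close> is left for \<open>G\<close>.\<close>
    proof (cases "\<exists>i\<in>{1..<s}. (r, i) \<notin> T")
      case True
      then obtain i where i: "i \<in> {1..<s}" "(r, i) \<notin> T"
        by blast
      have "\<exists>x\<in>{1..n l}. (l, x) \<notin> T" if "l \<in> {1..r}" for l
      proof (rule ccontr)
        assume "\<not> ?thesis"
        then have "Pair l ` {1..n l} \<subseteq> T"
          by auto
        then have "card (Pair l ` {1..n l}) \<le> card T"
          using finT by (intro card_mono)
        then show False
          using n[OF that] cardT by (simp add: card_image inj_on_def)
      qed
      then obtain f where f: "\<And>l. l \<in> {1..r} \<Longrightarrow> f l \<in> {1..n l} \<and> (l, f l) \<notin> T"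
        by metis
      have "restrict (f(r := i)) {1..r} \<in> ?F"
        using f i by (auto simp: PiE_iff)
      then show False
        using hit[of "restrict (f(r := i)) {1..r}"] f i by (auto split: if_splits)
    next
      case False
      let ?S = "Pair r ` {1..<s}"
      have "?S \<subseteq> T" "card ?S = s - 1"
        using False by (auto simp: card_image inj_on_def)
      then have "card (T - ?S) \<le> 1"
        using cardT finT by (simp add: card_Diff_subset)
      then have single: "v = w" if "v \<in> T - ?S" "w \<in> T - ?S" for v w
        using finT that by (simp add: card_le_Suc0_iff_eq)
      have not_S: "(l, A l) \<in> T - ?S" if "A \<in> G" "(l, A l) \<in> T" for A l
        using that G(2)[OF that(1)] by auto
      obtain l where l: "l \<in> {1..r}" "(l, B l) \<in> T"
        using hit[of B] B(1) by auto
      let ?B = "B(l := B l + 1)"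
      obtain k where k: "k \<in> {1..r}" "(k, ?B k) \<in> T"
        using hit[of ?B] B(2)[OF l(1)] by blast
      have "(l, B l) = (k, ?B k)"
        using not_S[OF B(1) l(2)] not_S[OF B(2)[OF l(1)] k(2)] by (rule single)
      then show False
        by auto
    qed
  qed
  then have tau: "s < transversal_number r n ?F"
    unfolding less_transversal_number_iff[OF F r] by blast
  show ?thesis
    using F nu tau card_F by blast
qed

text \<open>The centre is vertex \<open>s\<close> of the last part, and the reference edge is
  constantly 1 elsewhere. The star of the centre joins the \<open>s - 1\<close> full stars at the
  cost of \<open>?Q\<close>; \<open>?T\<close> has only \<open>n r - s\<close> edges because the
  labels up to \<open>s\<close> are taken.\<close>

lemma hm_construction:
  assumes r: "3 \<le> r" and s: "1 \<le> s" and n: "\<And>l. l \<in> {1..r} \<Longrightarrow> s < n l"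
  shows "\<exists>F\<subseteq>edges r n. matching_number r F \<le> s \<and> s < transversal_number r n F
    \<and> int (card F) = int s * (\<Prod>l=1..r-1. int (n l)) - (\<Prod>l=1..r-1. int (n l) - 1)
        + int (n r) - int s"
proof -
  let ?P = "PiE {1..r} ((\<lambda>l. {1..n l})(r := {s}))"
  let ?Q = "PiE {1..r} ((\<lambda>l. {2..n l})(r := {s}))"
  let ?T = "PiE {1..r} ((\<lambda>l. {1})(r := {s<..n r}))"
  let ?G = "(?P - ?Q) \<union> ?T"
  let ?B = "restrict ((\<lambda>l. 1)(r := s)) {1..r}"
  have n1: "1 \<le> n l" "2 \<le> n l" if "l \<in> {1..r}" for l
    using n[OF that] s by auto
  have Ir: "{1..r} - {r} = {1..r-1}"
    by auto
  have G_edges: "?G \<subseteq> edges r n"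
  proof -
    have "?P \<subseteq> edges r n" "?T \<subseteq> edges r n"
      unfolding edges_def using n n1 s r by (intro PiE_mono; auto simp: less_imp_le)+
    then show ?thesis by blast
  qed
  have one: "\<exists>l\<in>{1..r-1}. A l = 1" if "A \<in> ?P - ?Q" for A
  proof (rule ccontr)
    assume no: "\<not> ?thesis"
    have AP: "A \<in> ?P"
      using that by simp
    have "A \<in> ?Q"
    proof (rule PiE_I)
      fix l assume l: "l \<in> {1..r}"
      show "A l \<in> ((\<lambda>l. {2..n l})(r := {s})) l"
      proof (cases "l = r")
        case True
        then show ?thesis
          using PiE_mem[OF AP l] by simp
      next
        case False
        then have "A l \<noteq> 1"
          using no l by auto
        then show ?thesis
          using PiE_mem[OF AP l] False by auto
      qed
    next
      show "A l = undefined" if "l \<notin> {1..r}" for l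
        using AP that by (rule PiE_arb)
    qed
    then show False
      using that by simp
  qed
  have T1: "A l = 1" if "A \<in> ?T" "l \<in> {1..r-1}" for A l
  proof -
    have "l \<in> {1..r}" "l \<noteq> r"
      using that(2) r by auto
    then show ?thesis
      using PiE_mem[OF that(1), of l] by simp
  qed
  have P_r: "A r = s" if "A \<in> ?P" for A
    using PiE_mem[OF that, of r] r by simp
  have T_r: "s < A r" if "A \<in> ?T" for A
    using PiE_mem[OF that, of r] r by simp
  have construction: "\<exists>F\<subseteq>edges r n. matching_number r F \<le> s \<and> s < transversal_number r n F
    \<and> card F = (s - 1) * (\<Prod>l=1..r-1. n l) + card ?G"
  proof (rule stars_plus_intersecting[where B = ?B])
    show "1 \<le> r"
      using r by simp
    show "s \<le> A r" if "A \<in> ?G" for A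
      using that P_r[of A] T_r[of A] by auto
    show "\<exists>l\<in>{1..r}. A l = B l" if AB: "A \<in> ?G" "B \<in> ?G" for A B
    proof -
      have sub: "{1..r-1} \<subseteq> {1..r}" "r \<in> {1..r}" "1 \<in> {1..r-1}"
        using r by auto
      consider "A \<in> ?P" "B \<in> ?P" | "A \<in> ?P - ?Q" "B \<in> ?T" | "A \<in> ?T" "B \<in> ?P - ?Q" | "A \<in> ?T" "B \<in> ?T"
        using AB by blast
      then show ?thesis
      proof cases
        case 1
        then show ?thesis
          using P_r sub by (metis (no_types, lifting))
      next
        case 2
        then show ?thesis
          using one[of A] T1[of B] sub by (metis (no_types, lifting) subsetD)
      next
        case 3
        then show ?thesis
          using one[of B] T1[of A] sub by (metis (no_types, lifting) subsetD)
      next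
        case 4
        then show ?thesis
          using T1[of A 1] T1[of B 1] sub by (metis (no_types, lifting) subsetD)
      qed
    qed
    have in_G: "A \<in> ?G" if "A \<in> ?P" "l \<in> {1..r-1}" "A l = 1" for A l
    proof -
      have "A \<notin> ?Q"
      proof
        assume Q: "A \<in> ?Q"
        have "l \<in> {1..r}" "l \<noteq> r"
          using that(2) r by auto
        then show False
          using PiE_mem[OF Q, of l] that(3) by simp
      qed
      then show ?thesis
        using that(1) by blast
    qed
    have BP: "?B \<in> ?P"
      using n1 by (auto simp: PiE_iff)
    then show "?B \<in> ?G"
      using r by (intro in_G[of _ 1]) auto
    show "?B(l := ?B l + 1) \<in> ?G" if l: "l \<in> {1..r}" for l
    proof (cases "l = r")
      case True
      have "?B(r := ?B r + 1) \<in> ?T"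
        using n[of r] r by (auto simp: PiE_iff extensional_def)
      then show ?thesis
        using True by blast
    next
      case False
      then have "?B(l := ?B l + 1) \<in> ?P"
        using n1 l by (auto simp: PiE_iff extensional_def numeral_2_eq_2)
      \<comment> \<open>Raising coordinate \<open>l\<close> leaves another one equal to 1, as there
        are at least two coordinates before the last.\<close>
      then show ?thesis
        using False r by (intro in_G[of _ "if l = 1 then 2 else 1"]) auto
    qed
  qed (use assms G_edges in auto)
  have fin: "finite ?P" "finite ?Q" "finite ?T"
    by (auto intro!: finite_PiE)
  have "?Q \<subseteq> ?P"
    by (intro PiE_mono) auto
  have "A \<notin> ?T" if "A \<in> ?P" for A
    using P_r[OF that] T_r[of A] by blast
  then have "?P \<inter> ?T = {}"
    by blast
  then have "card ?G = card (?P - ?Q) + card ?T"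
    using fin by (intro card_Un_disjoint) auto
  moreover have "card (?P - ?Q) = card ?P - card ?Q" "card ?Q \<le> card ?P"
    using card_Diff_subset[OF fin(2) \<open>?Q \<subseteq> ?P\<close>] card_mono[OF fin(1) \<open>?Q \<subseteq> ?P\<close>] .
  ultimately have "int (card ?G) = int (card ?P) - int (card ?Q) + int (card ?T)"
    by linarith
  moreover have "int (card ?P) = (\<Prod>l=1..r-1. int (n l))"
    using r by (simp add: card_PiE_fun_upd Ir del: One_nat_def)
  moreover have "int (card ?Q) = (\<Prod>l=1..r-1. int (n l) - 1)"
  proof -
    have "int (card ?Q) = (\<Prod>l=1..r-1. int (card {2..n l}))"
      using r by (simp add: card_PiE_fun_upd Ir del: One_nat_def)
    also have "\<dots> = (\<Prod>l=1..r-1. int (n l) - 1)"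
      using n1 by (intro prod.cong) (auto simp: of_nat_diff)
    finally show ?thesis .
  qed
  moreover have "int (card ?T) = int (n r) - int s"
    using r n[of r] by (simp add: card_PiE_fun_upd of_nat_diff)
  moreover have "int ((s - 1) * (\<Prod>l=1..r-1. n l) + card ?G)
      = (int s - 1) * (\<Prod>l=1..r-1. int (n l)) + int (card ?G)"
    using s by (simp add: of_nat_diff)
  ultimately have "int ((s - 1) * (\<Prod>l=1..r-1. n l) + card ?G) = int s * (\<Prod>l=1..r-1. int (n l))
      - (\<Prod>l=1..r-1. int (n l) - 1) + int (n r) - int s"
    by (simp only: left_diff_distrib)
  then show ?thesis
    using construction by metis
qed

text \<open>The fixed vertices are 1 in parts 2 and 3 and \<open>s\<close> in part 4; part 1, the
  largest in the application, stays free. \<open>?B\<close> contains all three, so changing one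
  coordinate leaves at least two of them.\<close>

lemma two_of_three_construction:
  assumes s: "1 \<le> s" and n: "\<And>l. l \<in> {1..4} \<Longrightarrow> s < n l"
  shows "\<exists>F\<subseteq>edges 4 n. matching_number 4 F \<le> s \<and> s < transversal_number 4 n F
    \<and> int (card F) = int (n 1) * (int s * int (n 2) * int (n 3) - (int (n 2) - 1) * (int (n 3) - 1)
           + int (n 4) - int s)"
proof -
  let ?X = "\<lambda>S T U. PiE {1..4} ((\<lambda>l. {1..n l})(2 := S, 3 := T, 4 := U))"
  let ?G1 = "?X {1} {1} {s..n 4}" and ?G2 = "?X {1} {2..n 3} {s}" and ?G3 = "?X {2..n 2} {1} {s}"
  let ?G = "?G1 \<union> (?G2 \<union> ?G3)"
  let ?B = "restrict ((\<lambda>l. 1)(4 := s)) {1..4}"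
  have I4: "{1..4} = {1, 2, 3, 4::nat}"
    by auto
  have n': "s < n 1" "s < n 2" "s < n 3" "s < n 4"
    using n by auto
  have X: "A \<in> ?X S T U \<longleftrightarrow> A \<in> extensional {1..4} \<and> A 1 \<in> {1..n 1} \<and> A 2 \<in> S \<and> A 3 \<in> T \<and> A 4 \<in> U"
    for A S T U
    unfolding PiE_iff I4 by (simp del: One_nat_def) blast
  have edges_X: "A \<in> edges 4 n \<longleftrightarrow> A \<in> extensional {1..4} \<and> A 1 \<in> {1..n 1} \<and> A 2 \<in> {1..n 2}
      \<and> A 3 \<in> {1..n 3} \<and> A 4 \<in> {1..n 4}" for A
    unfolding edges_def PiE_iff I4 by (simp del: One_nat_def) blast
  have card_X: "card (?X S T U) = card S * card T * card U * n 1" for S T U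
  proof -
    have "{1..4} - {2, 3, 4} = {1::nat}"
      by auto
    then show ?thesis
      by (subst card_PiE_fun_upd3) auto
  qed
  have construction: "\<exists>F\<subseteq>edges 4 n. matching_number 4 F \<le> s \<and> s < transversal_number 4 n F
    \<and> card F = (s - 1) * (\<Prod>l=1..4-1. n l) + card ?G"
  proof (rule stars_plus_intersecting[where B = ?B])
    show "?G \<subseteq> edges 4 n"
      using n' s by (auto simp: X edges_X simp del: One_nat_def)
    show "s \<le> A 4" if "A \<in> ?G" for A
      using that by (auto simp: X simp del: One_nat_def)
    show "\<exists>l\<in>{1..4}. A l = B l" if "A \<in> ?G" "B \<in> ?G" for A B
    proof -
      have "A 2 = B 2 \<or> A 3 = B 3 \<or> A 4 = B 4"
        using that by (auto simp: X simp del: One_nat_def)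
      then show ?thesis
        unfolding I4 by blast
    qed
    show "?B \<in> ?G"
      using n' s by (simp add: X del: One_nat_def)
    show "?B(l := ?B l + 1) \<in> ?G" if "l \<in> {1..4}" for l
    proof -
      have "l = 1 \<or> l = 2 \<or> l = 3 \<or> l = 4"
        using that by auto
      then show ?thesis
        using n' s by (elim disjE) (simp_all add: X extensional_def del: One_nat_def)
    qed
  qed (use s n in auto)
  have fin: "finite (?X S T U)" if "finite S" "finite T" "finite U" for S T U
    using that by (intro finite_PiE) auto
  have "?G1 \<inter> (?G2 \<union> ?G3) = {}" "?G2 \<inter> ?G3 = {}"
    by (auto simp: X simp del: One_nat_def)
  then have "card ?G = card ?G1 + (card ?G2 + card ?G3)"
    using fin by (simp add: card_Un_disjoint del: fun_upd_apply)
  also have "\<dots> = (n 4 + 1 - s) * n 1 + ((n 3 - 1) * n 1 + (n 2 - 1) * n 1)"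
    unfolding card_X by (simp add: Suc_diff_le)
  finally have card_G: "card ?G = (n 4 + 1 - s) * n 1 + ((n 3 - 1) * n 1 + (n 2 - 1) * n 1)" .
  have "int (n 4 + 1 - s) = int (n 4) + 1 - int s" "int (n 3 - 1) = int (n 3) - 1"
    "int (n 2 - 1) = int (n 2) - 1"
    using n' by (auto simp: of_nat_diff)
  then have "int (card ?G) = int (n 1) * (int (n 2) + int (n 3) + int (n 4) - int s - 1)"
    unfolding card_G of_nat_add of_nat_mult by algebra
  moreover have "int (\<Prod>l=1..4-1. n l) = int (n 1) * int (n 2) * int (n 3)"
    by (simp add: numeral_3_eq_3 numeral_2_eq_2)
  moreover have "int (s - 1) = int s - 1"
    using s by (simp add: of_nat_diff)
  ultimately have "int ((s - 1) * (\<Prod>l=1..4-1. n l) + card ?G)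
      = int (n 1) * (int s * int (n 2) * int (n 3) - (int (n 2) - 1) * (int (n 3) - 1)
           + int (n 4) - int s)"
    unfolding of_nat_add of_nat_mult by algebra
  then show ?thesis
    using construction by metis
qed

section \<open>The extremal number\<close>

lemma prod_remove_le_prod_remove_min:
  fixes n :: "nat \<Rightarrow> nat"
  assumes "finite I" "k \<in> I" "q \<in> I" "n q \<le> n k"
  shows "(\<Prod>l\<in>I - {k}. n l) \<le> (\<Prod>l\<in>I - {q}. n l)"
proof (cases "k = q")
  case False
  have "(\<Prod>l\<in>I - {k}. n l) = n q * (\<Prod>l\<in>I - {k} - {q}. n l)"
    using assms False by (intro prod.remove) auto
  also have "\<dots> \<le> n k * (\<Prod>l\<in>I - {k} - {q}. n l)"
    using assms(4) by simp
  also have "I - {k} - {q} = I - {q} - {k}"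
    by auto
  also have "n k * (\<Prod>l\<in>I - {q} - {k}. n l) = (\<Prod>l\<in>I - {q}. n l)"
    using assms False by (intro prod.remove[symmetric]) auto
  finally show ?thesis .
qed simp

lemma card_edges_meeting_le:
  assumes "H \<subseteq> vertices r n" "1 \<le> r" "\<And>l. l \<in> {1..r} \<Longrightarrow> n r \<le> n l"
  shows "card {A \<in> edges r n. \<exists>v\<in>H. through v A} \<le> card H * (\<Prod>l=1..r-1. n l)"
proof -
  have finH: "finite H"
    using assms(1) finite_vertices finite_subset by blast
  have deg: "card {A \<in> edges r n. through v A} \<le> (\<Prod>l=1..r-1. n l)" if "v \<in> H" for v
  proof -
    have v: "fst v \<in> {1..r}"
      using that assms(1) by (auto simp: vertices_def)
    have "{A \<in> edges r n. through v A} \<subseteq> PiE {1..r} ((\<lambda>l. {1..n l})(fst v := {snd v}))"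
      by (auto simp: edges_def PiE_iff extensional_def)
    then have "card {A \<in> edges r n. through v A} \<le> card (PiE {1..r} ((\<lambda>l. {1..n l})(fst v := {snd v})))"
      by (intro card_mono finite_PiE) auto
    also have "\<dots> = (\<Prod>l\<in>{1..r} - {fst v}. n l)"
      using v by (simp add: card_PiE_fun_upd)
    also have "\<dots> \<le> (\<Prod>l\<in>{1..r} - {r}. n l)"
      using assms v by (intro prod_remove_le_prod_remove_min) auto
    also have "{1..r} - {r} = {1..r-1}"
      by auto
    finally show ?thesis .
  qed
  have "{A \<in> edges r n. \<exists>v\<in>H. through v A} = (\<Union>v\<in>H. {A \<in> edges r n. through v A})"
    by blast
  then have "card {A \<in> edges r n. \<exists>v\<in>H. through v A} \<le> (\<Sum>v\<in>H. card {A \<in> edges r n. through v A})"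
    using card_UN_le[OF finH] by simp
  also have "\<dots> \<le> (\<Sum>v\<in>H. (\<Prod>l=1..r-1. n l))"
    using deg by (rule sum_mono)
  finally show ?thesis by simp
qed

lemma parts_antimono:
  fixes n :: "nat \<Rightarrow> nat"
  assumes "\<And>l. l \<in> {1..<r} \<Longrightarrow> n (l + 1) \<le> n l" "1 \<le> i" "i \<le> j" "j \<le> r"
  shows "n j \<le> n i"
  using assms(3,4)
proof (induction j rule: dec_induct)
  case (step m)
  then show ?case
    using assms(1)[of m] assms(2) by simp
qed simp

text \<open>\<open>few\<close> makes \<open>G\<close> no larger than one full star, which settles
  the case of fewer than \<open>s - 1\<close> heavy vertices; \<open>small\<close> puts intersecting
  families with leading coefficient \<open>r - 2\<close> below the Hilton--Milner bound. The
  remaining cases are compared exactly through the gaps.\<close>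

lemma upper_bound:
  assumes r: "3 \<le> r" and s: "1 \<le> s"
    and n: "\<And>l. l \<in> {1..<r} \<Longrightarrow> n (l + 1) \<le> n l" "s < n r"
    and few: "s * r * ((r + 1) * (s + 1)) * n 1 ^ (r - 2) \<le> n r ^ (r - 1)"
    and small: "(r - 2) * n 1 ^ (r - 2) + r ^ 3 * n 1 ^ (r - 3) \<le> (r - 1) * (n r - 1) ^ (r - 2)"
    and F: "F \<subseteq> edges r n" "matching_number r F \<le> s" "s < transversal_number r n F"
  defines "b \<equiv> int s * (\<Prod>l=1..r-1. int (n l)) - (\<Prod>l=1..r-1. int (n l) - 1) + int (n r) - int s"
    and "b' \<equiv> int (n 1) * (int s * int (n 2) * int (n 3) - (int (n 2) - 1) * (int (n 3) - 1)
           + int (n 4) - int s)"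
  shows "int (card F) \<le> b \<or> r = 4 \<and> int (card F) \<le> b'"
proof -
  have le1: "n l \<le> n 1" and ler: "n r \<le> n l" if "1 \<le> l" "l \<le> r" for l
    using parts_antimono[of r n 1 l] parts_antimono[of r n l r] n(1) that by auto
  let ?P = "\<Prod>l=1..r-1. int (n l)" and ?Q = "\<Prod>l=1..r-1. int (n l) - 1"
  have finF: "finite F"
    using F finite_edges finite_subset by blast
  have power_eq: "int (card {1..r-1}) * (int (n r) - 1) ^ (card {1..r-1} - 1)
      = int ((r - 1) * (n r - 1) ^ (r - 2))"
    using n(2) by (simp add: of_nat_diff numeral_2_eq_2)
  have "int (card {1..r-1}) * (int (n r) - 1) ^ (card {1..r-1} - 1) \<le> ?P - ?Q"
    using ler n(2) by (intro prod_minus_prod_diff_one_ge) auto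
  then have PQ: "int ((r - 1) * (n r - 1) ^ (r - 2)) \<le> ?P - ?Q"
    unfolding power_eq .
  have D: "n l \<le> n 1" if "l \<in> {1..r}" for l
    using le1 that by simp
  obtain H where H: "H \<subseteq> vertices r n" "card H < s"
    and card_G: "card {A \<in> F. \<forall>v\<in>H. \<not> through v A} \<le> s * r * ((r + 1) * (s + 1) * n 1 ^ (r - 2))"
    and G_int: "card H = s - 1 \<longrightarrow> (\<forall>A\<in>{A \<in> F. \<forall>v\<in>H. \<not> through v A}.
       \<forall>B\<in>{A \<in> F. \<forall>v\<in>H. \<not> through v A}. \<exists>l\<in>{1..r}. A l = B l)"
    and G_nontriv: "card H = s - 1
       \<longrightarrow> (\<forall>l\<in>{1..r}. \<forall>x. \<exists>A\<in>{A \<in> F. \<forall>v\<in>H. \<not> through v A}. A l \<noteq> x)"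
    by (rule heavy_vertices[OF F(1) r s D F(2,3)])
  have finH: "finite H"
    using H finite_vertices finite_subset by blast
  let ?G = "{A \<in> F. \<forall>v\<in>H. \<not> through v A}" and ?S = "{A \<in> edges r n. \<exists>v\<in>H. through v A}"
  have "F \<subseteq> ?S \<union> ?G"
    using F(1) by blast
  then have "card F \<le> card (?S \<union> ?G)"
    using finF finite_edges by (intro card_mono) auto
  also have "\<dots> \<le> card ?S + card ?G"
    by (rule card_Un_le)
  finally have card_F: "card F \<le> card ?S + card ?G" .
  have card_S: "card ?S \<le> card H * (\<Prod>l=1..r-1. n l)"
    using r ler H by (intro card_edges_meeting_le) auto
  consider "card H + 2 \<le> s" | "card H = s - 1"
    using H(2) by linarith
  then show ?thesis
  proof cases
    case 1
    have "card ?G \<le> n r ^ (r - 1)"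
      using card_G few unfolding mult.assoc by (rule order.trans)
    also have "\<dots> = (\<Prod>l=1..r-1. n r)"
      by simp
    also have "\<dots> \<le> (\<Prod>l=1..r-1. n l)"
      using ler by (intro prod_mono) auto
    finally have "card F \<le> (card H + 1) * (\<Prod>l=1..r-1. n l)"
      using card_F card_S by simp
    also have "\<dots> \<le> (s - 1) * (\<Prod>l=1..r-1. n l)"
      using 1 by (intro mult_right_mono) auto
    finally have "int (card F) \<le> int ((s - 1) * (\<Prod>l=1..r-1. n l))"
      by (simp only: of_nat_le_iff)
    also have "\<dots> = (int s - 1) * ?P"
      using s by (simp add: of_nat_diff)
    finally have "int (card F) \<le> b"
      using PQ n(2) by (simp add: b_def algebra_simps)
    then show ?thesis ..
  next
    case 2
    \<comment> \<open>Deleting \<open>H\<close> leaves the parts \<open>Y l\<close>; the deficits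
      \<open>n l - m l\<close> add up to \<open>card H\<close>.\<close>
    define Y where "Y = (\<lambda>l. {1..n l} - {x. (l, x) \<in> H})"
    define m where "m = (\<lambda>l. int (card (Y l)))"
    have hl: "int (n l) - m l = int (card {x. (l, x) \<in> H})" "{x. (l, x) \<in> H} \<subseteq> {1..n l}"
      if "l \<in> {1..r}" for l
    proof -
      show sub: "{x. (l, x) \<in> H} \<subseteq> {1..n l}"
        using H(1) by (auto simp: vertices_def)
      then have "card {x. (l, x) \<in> H} \<le> n l"
        using card_mono[of "{1..n l}" "{x. (l, x) \<in> H}"] by simp
      then show "int (n l) - m l = int (card {x. (l, x) \<in> H})"
        using sub finite_subset[OF sub] by (simp add: m_def Y_def card_Diff_subset of_nat_diff)
    qed
    have "H = (SIGMA l:{1..r}. {x. (l, x) \<in> H})"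
      using H(1) by (auto simp: vertices_def)
    then have "card H = card (SIGMA l:{1..r}. {x. (l, x) \<in> H})"
      by (rule arg_cong)
    also have "\<dots> = (\<Sum>l\<in>{1..r}. card {x. (l, x) \<in> H})"
    proof (rule card_SigmaI)
      show "\<forall>l\<in>{1..r}. finite {x. (l, x) \<in> H}"
        using hl(2) finite_subset by blast
    qed simp
    finally have "int (card H) = (\<Sum>l\<in>{1..r}. int (card {x. (l, x) \<in> H}))"
      by (simp only: of_nat_sum)
    also have "\<dots> = (\<Sum>l\<in>{1..r}. int (n l) - m l)"
      using hl(1) by (intro sum.cong) auto
    finally have deficit: "(\<Sum>l\<in>{1..r}. int (n l) - m l) = int s - 1"
      using 2 s by (simp add: of_nat_diff)
    have m_le: "m l \<le> int (n l)" if "l \<in> {1..r}" for l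
      using hl(1)[OF that] by linarith
    have m_ge: "1 \<le> m l" if "l \<in> {1..r}" for l
    proof -
      have "int (n l) - m l \<le> (\<Sum>l\<in>{1..r}. int (n l) - m l)"
        using that m_le by (intro member_le_sum) auto
      then show ?thesis
        using deficit n(2) ler[of l] that by simp
    qed
    have avoid: "{A \<in> edges r n. \<forall>v\<in>H. \<not> through v A} = PiE {1..r} Y"
    proof -
      have "(\<forall>v\<in>H. \<not> through v A) \<longleftrightarrow> (\<forall>l\<in>{1..r}. (l, A l) \<notin> H)" for A
      proof -
        have "fst v \<in> {1..r}" if "v \<in> H" for v
          using H(1) that by (auto simp: vertices_def)
        then show ?thesis
          by (metis prod.collapse fst_conv snd_conv)
      qed
      then show ?thesis
        by (auto simp: edges_def Y_def PiE_iff extensional_def)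
    qed
    \<comment> \<open>Unlike the union bound \<open>card_S\<close>, this count of the edges meeting
      \<open>H\<close> is exact; its product of the \<open>m l\<close> cancels against the bound for
      \<open>?G\<close>.\<close>
    have "?S = edges r n - PiE {1..r} Y"
      using avoid by blast
    moreover have "PiE {1..r} Y \<subseteq> edges r n"
      using avoid by blast
    ultimately have "card ?S = card (edges r n) - card (PiE {1..r} Y)"
        "card (PiE {1..r} Y) \<le> card (edges r n)"
      using finite_edges finite_subset card_Diff_subset card_mono by metis+
    then have card_S': "int (card ?S) = (\<Prod>l\<in>{1..r}. int (n l)) - (\<Prod>l\<in>{1..r}. m l)"
      by (simp add: of_nat_diff edges_def card_PiE m_def)
    interpret nontrivial_intersecting r "n 1" Y ?G
    proof
      show "?G \<subseteq> PiE {1..r} Y"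
        using avoid F(1) by blast
      show "card (Y l) \<le> n 1" if "l \<in> {1..r}" for l
        using m_le[OF that] le1[of l] that by (simp add: m_def)
      show "\<exists>l\<in>{1..r}. A l = B l" if "A \<in> ?G" "B \<in> ?G" for A B
        using G_int 2 that by blast
      show "\<exists>A\<in>?G. A l \<noteq> x" if "l \<in> {1..r}" for l x
        using G_nontriv 2 that by blast
    qed (use r in \<open>auto simp: Y_def\<close>)
    have hm_bound: "int (card F) \<le> b"
      if "k \<in> {1..r}" "int (card ?G) \<le> (\<Prod>l\<in>{1..r}. m l) - hm_gap {1..r} m k" for k
    proof -
      have "hm_gap {1..r} ((\<lambda>l. int (n l))(r := int (n r) - (int s - 1))) r \<le> hm_gap {1..r} m k"
        using that r ler m_le m_ge deficit by (intro hm_gap_min) auto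
      then have "int (card F) \<le> (\<Prod>l\<in>{1..r}. int (n l))
          - hm_gap {1..r} ((\<lambda>l. int (n l))(r := int (n r) - (int s - 1))) r"
        using card_F card_S' that(2) by linarith
      also have "\<dots> = b"
      proof -
        have Ir: "{1..r} - {r} = {1..r-1}"
          by auto
        have "(\<Prod>l\<in>{1..r}. int (n l)) = int (n r) * ?P"
          using prod.remove[of "{1..r}" r "\<lambda>l. int (n l)"] r Ir by simp
        moreover have "hm_gap {1..r} ((\<lambda>l. int (n l))(r := int (n r) - (int s - 1))) r
            = (int (n r) - int s) * (?P - 1) + ?Q"
        proof -
          have "(\<Prod>l=1..r-1. ((\<lambda>l. int (n l))(r := int (n r) - (int s - 1))) l) = ?P"
            "(\<Prod>l=1..r-1. ((\<lambda>l. int (n l))(r := int (n r) - (int s - 1))) l - 1) = ?Q"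
            using r by (auto intro!: prod.cong)
          then show ?thesis
            unfolding hm_gap_def Ir by simp
        qed
        ultimately show ?thesis
          by (simp add: b_def algebra_simps)
      qed
      finally show ?thesis .
    qed
    show ?thesis
    proof (cases rule: card_cases)
      case small_G: small
      \<comment> \<open>The smaller leading term of \<open>?G\<close> leaves room for the crude
        bound \<open>card_S\<close>.\<close>
      have "int (card ?S) \<le> int ((s - 1) * (\<Prod>l=1..r-1. n l))"
        using card_S 2 by (simp only: of_nat_le_iff)
      also have "\<dots> = (int s - 1) * ?P"
        using s by (simp add: of_nat_diff)
      finally have "int (card F) \<le> (int s - 1) * ?P + int (card ?G)"
        using card_F by linarith
      moreover have "int (card ?G) \<le> ?P - ?Q"
        using small_G small PQ by linarith
      ultimately have "int (card F) \<le> b"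
        using n(2) by (simp add: b_def algebra_simps)
      then show ?thesis ..
    next
      case (hm k)
      then have "int (card F) \<le> b"
        using hm_bound by (simp add: m_def)
      then show ?thesis ..
    next
      case (two_of_three a b c)
      let ?J = "{1..r} - {a, b, c}"
      have card_abc: "card {a, b, c} = 3"
        using two_of_three by simp
      have G_le: "int (card ?G) \<le> (\<Prod>l\<in>?J. m l) * ((\<Sum>l\<in>{a, b, c}. m l) - 2)"
        using two_of_three by (simp add: m_def add.assoc)
      have cardJ: "card ?J = r - 3"
        using two_of_three card_abc by (subst card_Diff_subset) auto
      have abc: "{a, b, c} = {1..r} - ?J"
        using two_of_three by auto
      from two_of_three(1) show ?thesis
      proof
        \<comment> \<open>The bound \<open>m 1 + m 2 + m 3 - 2\<close> is the Hilton--Milner size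
          with centre in part 3, so \<open>hm_bound\<close> applies.\<close>
        assume r3: "r = 3"
        then have J: "?J = {}"
          using cardJ by simp
        have I3: "{1..3} = {1, 2, 3::nat}" "{1..3} - {3} = {1, 2::nat}"
          by auto
        have abc3: "{a, b, c} = {1, 2, 3}"
          by (subst abc, unfold J, unfold r3 I3) simp
        have "int (card ?G) \<le> m 1 + m 2 + m 3 - 2"
          using G_le unfolding J unfolding abc3 by simp
        moreover have "(\<Prod>l\<in>{1..r}. m l) = m 1 * m 2 * m 3"
          unfolding r3 I3 by simp
        moreover have "hm_gap {1..r} m 3 = (m 3 - 1) * (m 1 * m 2 - 1) + (m 1 - 1) * (m 2 - 1)"
          unfolding r3 hm_gap_def I3 by (simp add: insert_Diff_if)
        ultimately have "int (card ?G) \<le> (\<Prod>l\<in>{1..r}. m l) - hm_gap {1..r} m 3"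
          by (simp add: algebra_simps)
        then show ?thesis
          using hm_bound[of 3] r3 by simp
      next
        assume r4: "r = 4"
        then obtain e where e: "?J = {e}"
          using cardJ by (auto simp: card_1_singleton_iff)
        then have "e \<in> {1..4}"
          using r4 by blast
        then have "e = 1 \<or> e = 2 \<or> e = 3 \<or> e = 4"
          by auto
        have I4: "{1..4} = {1, 2, 3, 4::nat}"
          by auto
        let ?gaps = "{two_of_three_gap (m 1) (m 2) (m 3) (m 4), two_of_three_gap (m 2) (m 1) (m 3) (m 4),
          two_of_three_gap (m 3) (m 1) (m 2) (m 4), two_of_three_gap (m 4) (m 1) (m 2) (m 3)}"
        have G_e: "int (card ?G) \<le> m e * ((\<Sum>l\<in>{1, 2, 3, 4} - {e}. m l) - 2)"
        proof -
          have abc4: "{a, b, c} = {1, 2, 3, 4} - {e}"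
            by (subst abc, unfold e, unfold r4 I4) simp
          show ?thesis
            using G_le unfolding e unfolding abc4 by simp
        qed
        have prod4: "(\<Prod>l\<in>{1..r}. f l) = f 1 * f 2 * f 3 * f 4" for f :: "nat \<Rightarrow> int"
          unfolding r4 I4 by (simp add: mult.assoc)
        have "\<exists>g\<in>?gaps. int (card ?G) \<le> (\<Prod>l\<in>{1..r}. m l) - g"
          using \<open>e = 1 \<or> e = 2 \<or> e = 3 \<or> e = 4\<close>
        proof (elim disjE)
          assume "e = 1"
          then have "int (card ?G) \<le> (\<Prod>l\<in>{1..r}. m l) - two_of_three_gap (m 1) (m 2) (m 3) (m 4)"
            using G_e unfolding prod4
              by (simp add: two_of_three_gap_def insert_Diff_if algebra_simps)
          then show ?thesis by blast
        next
          assume "e = 2"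
          then have "int (card ?G) \<le> (\<Prod>l\<in>{1..r}. m l) - two_of_three_gap (m 2) (m 1) (m 3) (m 4)"
            using G_e unfolding prod4
              by (simp add: two_of_three_gap_def insert_Diff_if algebra_simps)
          then show ?thesis by blast
        next
          assume "e = 3"
          then have "int (card ?G) \<le> (\<Prod>l\<in>{1..r}. m l) - two_of_three_gap (m 3) (m 1) (m 2) (m 4)"
            using G_e unfolding prod4
              by (simp add: two_of_three_gap_def insert_Diff_if algebra_simps)
          then show ?thesis by blast
        next
          assume "e = 4"
          then have "int (card ?G) \<le> (\<Prod>l\<in>{1..r}. m l) - two_of_three_gap (m 4) (m 1) (m 2) (m 3)"
            using G_e unfolding prod4
              by (simp add: two_of_three_gap_def insert_Diff_if algebra_simps)
          then show ?thesis by blast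
        qed
        then obtain g where g: "g \<in> ?gaps" "int (card ?G) \<le> (\<Prod>l\<in>{1..r}. m l) - g"
          by blast
        have "two_of_three_gap (int (n 1)) (int (n 2)) (int (n 3)) (int (n 4) - (int s - 1)) \<le> Min ?gaps"
        proof (rule two_of_three_gap_min)
          show "int (n 2) \<le> int (n 1)" "int (n 3) \<le> int (n 2)" "int (n 4) \<le> int (n 3)"
            using parts_antimono[of r n 1 2] parts_antimono[of r n 2 3] parts_antimono[of r n 3 4]
              n(1) r4 by auto
          have "(\<Sum>l\<in>{1, 2, 3, 4}. int (n l) - m l) = int s - 1"
            using deficit unfolding r4 I4 .
          then show "int (n 1) - m 1 + (int (n 2) - m 2) + (int (n 3) - m 3) + (int (n 4) - m 4) = int s - 1"
            by simp
        qed (use m_le m_ge r4 in auto)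
        also have "\<dots> \<le> g"
          using g(1) by (intro Min_le) auto
        finally have "int (card F) \<le> (\<Prod>l\<in>{1..r}. int (n l))
            - two_of_three_gap (int (n 1)) (int (n 2)) (int (n 3)) (int (n 4) - (int s - 1))"
          using card_F card_S' g(2) by linarith
        also have "\<dots> = b'"
          unfolding prod4 b'_def two_of_three_gap_def by (simp add: algebra_simps)
        finally show ?thesis
          using r4 by blast
      qed
    qed
  qed
qed

theorem theorem3p3:
  fixes r s :: nat
  assumes "r \<ge> 3" and "s \<ge> 1"
  shows "\<exists>\<delta>::real. \<delta> > 0 \<and> (\<exists>N::nat. N > 0 \<and>
     (\<forall>n :: nat \<Rightarrow> nat.
        (\<forall>l\<in>{1..<r}. n (l + 1) \<le> n l) \<and> n r \<ge> N \<and> real (n 1) \<le> (1 + \<delta>) * real (n r) \<longrightarrow>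
        (if r \<noteq> 4 then
           int (m0 s r n) = int s * (\<Prod>l=1..r-1. int (n l)) - (\<Prod>l=1..r-1. int (n l) - 1)
                            + int (n r) - int s
         else
           int (m0 s r n) = max
             (int s * (\<Prod>l=1..3. int (n l)) - (\<Prod>l=1..3. int (n l) - 1) + int (n 4) - int s)
             (int (n 1) * (int s * int (n 2) * int (n 3) - (int (n 2) - 1) * (int (n 3) - 1)
                           + int (n 4) - int s)))))"
proof -
  let ?C = "s * r * ((r + 1) * (s + 1))"
  have r': "Suc (r - 2) = r - 1" "Suc (r - 3) = r - 2"
    using assms(1) by auto
  \<comment> \<open>Leading coefficient 0 expresses that \<open>?C * n 1 ^ (r - 2)\<close> is of
    lower order than exponent \<open>r - 1\<close>.\<close>
  obtain \<delta>1 N1 where few: "0 < \<delta>1" "0 < N1"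
    "\<And>D d :: nat. N1 \<le> d \<Longrightarrow> d \<le> D \<Longrightarrow> real D \<le> (1 + \<delta>1) * real d \<Longrightarrow>
       0 * real D ^ Suc (r - 2) + real ?C * real D ^ (r - 2) \<le> 1 * (real d - 1) ^ Suc (r - 2)"
    using perturbed_power_less[of 0 1 "real ?C" "r - 2"] by auto
  \<comment> \<open>The strict inequality \<open>r - 2 < r - 1\<close>, one missing leaf, makes room
    for the lower-order term and for unequal parts.\<close>
  obtain \<delta>2 N2 where small: "0 < \<delta>2" "0 < N2"
    "\<And>D d :: nat. N2 \<le> d \<Longrightarrow> d \<le> D \<Longrightarrow> real D \<le> (1 + \<delta>2) * real d \<Longrightarrow>
       real (r - 2) * real D ^ Suc (r - 3) + real (r ^ 3) * real D ^ (r - 3)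
         \<le> real (r - 1) * (real d - 1) ^ Suc (r - 3)"
    using perturbed_power_less[of "real (r - 2)" "real (r - 1)" "real (r ^ 3)" "r - 3"] assms(1) by auto
  define \<delta> where "\<delta> = min \<delta>1 \<delta>2"
  \<comment> \<open>The entry \<open>s + 1\<close> ensures \<open>s < n r\<close>, so that both
    constructions fit.\<close>
  define N where "N = max (max N1 N2) (s + 1)"
  let ?b = "\<lambda>n. int s * (\<Prod>l=1..r-1. int (n l)) - (\<Prod>l=1..r-1. int (n l) - 1) + int (n r) - int s"
  let ?b' = "\<lambda>n. int (n 1) * (int s * int (n 2) * int (n 3) - (int (n 2) - 1) * (int (n 3) - 1)
                           + int (n 4) - int s)"
  have main: "?b n \<le> int (m0 s r n) \<and> (r = 4 \<longrightarrow> ?b' n \<le> int (m0 s r n))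
      \<and> (int (m0 s r n) \<le> ?b n \<or> r = 4 \<and> int (m0 s r n) \<le> ?b' n)"
    if n: "\<forall>l\<in>{1..<r}. n (l + 1) \<le> n l" "N \<le> n r" "real (n 1) \<le> (1 + \<delta>) * real (n r)"
    for n :: "nat \<Rightarrow> nat"
  proof -
    have ler: "n r \<le> n l" if "1 \<le> l" "l \<le> r" for l
      using parts_antimono[of r n l r] n(1) that by auto
    have nr: "N1 \<le> n r" "N2 \<le> n r" "s < n r" "n r \<le> n 1"
      using n(2) ler[of 1] assms(1) by (auto simp: N_def)
    have "(1 + \<delta>) * real (n r) \<le> (1 + \<delta>1) * real (n r)" "(1 + \<delta>) * real (n r) \<le> (1 + \<delta>2) * real (n r)"
      by (auto intro!: mult_right_mono simp: \<delta>_def)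
    then have d: "real (n 1) \<le> (1 + \<delta>1) * real (n r)" "real (n 1) \<le> (1 + \<delta>2) * real (n r)"
      using n(3) by linarith+
    have n_sub: "real (n r) - 1 = real (n r - 1)"
      using nr(3) by simp
    have "real (?C * n 1 ^ (r - 2)) \<le> real ((n r - 1) ^ (r - 1))"
      using few(3)[OF nr(1) nr(4) d(1)] unfolding r' n_sub by simp
    then have "?C * n 1 ^ (r - 2) \<le> (n r - 1) ^ (r - 1)"
      by (simp only: of_nat_le_iff)
    also have "\<dots> \<le> n r ^ (r - 1)"
      by (rule power_mono) auto
    finally have few': "?C * n 1 ^ (r - 2) \<le> n r ^ (r - 1)" .
    have "real ((r - 2) * n 1 ^ (r - 2) + r ^ 3 * n 1 ^ (r - 3)) \<le> real ((r - 1) * (n r - 1) ^ (r - 2))"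
      using small(3)[OF nr(2) nr(4) d(2)] unfolding r' n_sub by simp
    then have small': "(r - 2) * n 1 ^ (r - 2) + r ^ 3 * n 1 ^ (r - 3) \<le> (r - 1) * (n r - 1) ^ (r - 2)"
      by (simp only: of_nat_le_iff)
    have n_gt: "s < n l" if "l \<in> {1..r}" for l
      using ler[of l] nr(3) that by auto
    obtain F where F: "F \<subseteq> edges r n" "matching_number r F \<le> s" "s < transversal_number r n F"
      "int (card F) = ?b n"
      using hm_construction[of r s n] assms n_gt by blast
    obtain F0 where F0: "F0 \<subseteq> edges r n" "matching_number r F0 \<le> s" "s < transversal_number r n F0"
      "card F0 = m0 s r n"
      using m0_attained[OF F(1-3)] by blast
    have "?b n \<le> int (m0 s r n)"
      using card_le_m0[OF F(1-3)] F(4) by linarith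
    moreover have "?b' n \<le> int (m0 s r n)" if r4: "r = 4"
    proof -
      obtain F' where F': "F' \<subseteq> edges r n" "matching_number r F' \<le> s" "s < transversal_number r n F'"
        "int (card F') = ?b' n"
        using two_of_three_construction[of s n] assms(2) n_gt unfolding r4 by blast
      then show ?thesis
        using card_le_m0[OF F'(1-3)] by linarith
    qed
    moreover have "int (card F0) \<le> ?b n \<or> r = 4 \<and> int (card F0) \<le> ?b' n"
      using n(1) F0 by (intro upper_bound[OF assms _ nr(3) few' small']) auto
    ultimately show ?thesis
      using F0(4) by simp
  qed
  show ?thesis
  proof (intro exI[of _ \<delta>] exI[of _ N] conjI allI impI)
    show "0 < \<delta>" "0 < N"
      using few small by (auto simp: \<delta>_def N_def)
    fix n :: "nat \<Rightarrow> nat"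
    assume "(\<forall>l\<in>{1..<r}. n (l + 1) \<le> n l) \<and> n r \<ge> N \<and> real (n 1) \<le> (1 + \<delta>) * real (n r)"
    then have "?b n \<le> int (m0 s r n) \<and> (r = 4 \<longrightarrow> ?b' n \<le> int (m0 s r n))
      \<and> (int (m0 s r n) \<le> ?b n \<or> r = 4 \<and> int (m0 s r n) \<le> ?b' n)"
      by (intro main) auto
    then show "if r \<noteq> 4 then
           int (m0 s r n) = int s * (\<Prod>l=1..r-1. int (n l)) - (\<Prod>l=1..r-1. int (n l) - 1)
                            + int (n r) - int s
         else
           int (m0 s r n) = max
             (int s * (\<Prod>l=1..3. int (n l)) - (\<Prod>l=1..3. int (n l) - 1) + int (n 4) - int s)
             (int (n 1) * (int s * int (n 2) * int (n 3) - (int (n 2) - 1) * (int (n 3) - 1)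
                           + int (n 4) - int s))"
      by (cases "r = 4") auto
  qed
qed

end
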